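(* Let $f,g\in H^1(\mathbb{D})$ satisfy $|f|=|g|$ almost everywhere on $\mathbb{T}$ (in the sense of radial limits) and $|f|=|g|$ on an infinite subset $X\subset r\mathbb{T}$ for some $0<r<1$. Then $f=\lambda g$ for some $\lambda\in\mathbb{T}$.
   Context: $\mathbb{D}$ is the open unit disc, $\mathbb{T}$ the unit circle, $r\mathbb{T}=\{z:|z|=r\}$, and $H^1(\mathbb{D})$ is the Hardy space of the disc. *)

theory Defs
  imports "HOL-Analysis.Analysis"
begin

definition hardy1 :: "(complex \<Rightarrow> complex) \<Rightarrow> bool" where
  "hardy1 f \<longleftrightarrow> f holomorphic_on ball 0 1 \<and>
     (\<exists>C. \<forall>r. 0 < r \<and> r < 1 \<longrightarrow>
        integral {0..2*pi} (\<lambda>t. norm (f (complex_of_real r * cis t))) \<le> C)"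

definition radial_limit :: "(complex \<Rightarrow> complex) \<Rightarrow> real \<Rightarrow> complex" where
  "radial_limit f t = Lim (at_left 1) (\<lambda>\<rho>::real. f (complex_of_real \<rho> * cis t))"

end

theory Submission
  imports Defs "HOL-Complex_Analysis.Complex_Analysis"
begin

text \<open>Write \<open>f\<^sup>* z = cnj (f (r\<^sup>2 / cnj z))\<close> for the reflection of \<open>f\<close> in the circle \<open>|z| = r\<close>. Since \<open>|f| = |g|\<close> on an
  infinite subset of that circle, the identity theorem gives \<open>f f\<^sup>* = g g\<^sup>*\<close> for \<open>r\<^sup>2 < |z| < 1\<close>. The
  functions \<open>f\<^sup>*\<close> and \<open>g\<^sup>*\<close> are holomorphic across the unit circle, where almost everywhere \<open>f\<close> and \<open>g\<close> have nonzero
  radial limits of equal modulus; hence \<open>|f\<^sup>*| = |g\<^sup>*|\<close> there, and reflecting once more, now in the unit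
  circle, gives \<open>f\<^sup>*(z) f(r\<^sup>2 z) = g\<^sup>*(z) g(r\<^sup>2 z)\<close>. Eliminating the reflections leaves
  \<open>f(z) g(r\<^sup>2 z) = g(z) f(r\<^sup>2 z)\<close>, and comparing orders at the origin shows that \<open>f\<close> is a multiple of \<open>g\<close>.

  The boundary behaviour is controlled by functions \<open>exp p\<close> with \<open>p\<close> a polynomial: real parts of
  polynomials are uniformly dense in the continuous functions on the unit circle, so these can replace outer functions.
  The maximum modulus principle then gives Jensen's inequality, bounded multipliers for Hardy functions, and the
  passage from limits along the circle to limits from inside the disc. Fatou's theorem follows by applying the last
  of these to the difference quotient of a primitive, which is Lipschitz on the circle and therefore
  differentiable almost everywhere.\<close>

subsection \<open>The maximum modulus principle with an exceptional boundary point\<close>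

lemma continuous_on_extend_point:
  fixes f :: "'a::t1_space \<Rightarrow> 'b::topological_space"
  assumes cont: "continuous_on (S - {a}) f" and lim: "(f \<longlongrightarrow> l) (at a within S)"
  shows "continuous_on S (\<lambda>x. if x = a then l else f x)"
  unfolding continuous_on_def
proof
  fix x assume "x \<in> S"
  show "((\<lambda>x. if x = a then l else f x) \<longlongrightarrow> (if x = a then l else f x)) (at x within S)"
  proof (cases "x = a")
    case True
    have "\<forall>\<^sub>F x in at a within S. f x = (if x = a then l else f x)"
      by (simp add: eventually_at_filter)
    from Lim_transform_eventually[OF lim this] show ?thesis using True by simp
  next
    case False
    have "\<forall>\<^sub>F y in nhds x. y \<in> - {a}"
      using False by (intro eventually_nhds_in_open) auto
    then have eventually_eq: "\<forall>\<^sub>F y in at x within S. f y = (if y = a then l else f y)"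
      unfolding eventually_at_filter by eventually_elim simp
    have "at x within S = at x within S - {a}"
      using False by (intro at_within_nhd[of x "- {a}"]) auto
    then have "(f \<longlongrightarrow> f x) (at x within S)"
      using cont \<open>x \<in> S\<close> False by (simp add: continuous_on_def)
    from Lim_transform_eventually[OF this eventually_eq] show ?thesis using False by simp
  qed
qed

lemma maximum_modulus_cball:
  fixes f :: "complex \<Rightarrow> complex"
  assumes "continuous_on (cball a r) f" "f holomorphic_on ball a r"
    and "\<And>z. z \<in> sphere a r \<Longrightarrow> norm (f z) \<le> B" and "z \<in> cball a r"
  shows "norm (f z) \<le> B"
  by (rule maximum_modulus_frontier[of f "cball a r"]) (use assms in simp_all)

lemma continuous_on_mult_vanishing_factor:
  fixes f :: "complex \<Rightarrow> complex"
  assumes cont: "continuous_on (S - {a}) f" and bounded: "\<And>z. z \<in> S - {a} \<Longrightarrow> norm (f z) \<le> M"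
  shows "continuous_on S (\<lambda>z. if z = a then 0 else f z * (z - a))"
proof (rule continuous_on_extend_point)
  show "continuous_on (S - {a}) (\<lambda>z. f z * (z - a))" by (intro continuous_intros cont)
  have "norm (f z * (z - a)) \<le> norm (z - a) * M" if "z \<in> S" for z
    using bounded[of z] that by (cases "z = a") (auto simp: norm_mult mult.commute intro!: mult_left_mono)
  then have "\<forall>\<^sub>F z in at a within S. norm (f z * (z - a)) \<le> norm (z - a) * M"
    by (simp add: eventually_at_filter)
  moreover have "((\<lambda>z. z - a) \<longlongrightarrow> 0) (at a within S)"
    using tendsto_diff[OF tendsto_ident_at[of a] tendsto_const[of a]] by simp
  ultimately show "((\<lambda>z. f z * (z - a)) \<longlongrightarrow> 0) (at a within S)"
    by (rule tendsto_0_le[rotated])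
qed

lemma maximum_modulus_cball_weighted:
  fixes f :: "complex \<Rightarrow> complex"
  assumes cont: "continuous_on (cball c r - {a}) f" and holo: "f holomorphic_on ball c r"
    and a: "a \<in> sphere c r" and r: "0 < r"
    and bounded: "\<And>z. z \<in> cball c r - {a} \<Longrightarrow> norm (f z) \<le> M"
    and le_B: "\<And>z. z \<in> sphere c r - {a} \<Longrightarrow> norm (f z) \<le> B" and z: "z \<in> ball c r"
  shows "norm (f z) * norm (z - a) \<le> B * (2 * r)"
proof -
  define k where "k = (\<lambda>z. if z = a then 0 else f z * (z - a))"
  have "2 * c - a \<in> sphere c r - {a}"
    using a r by (auto simp: dist_norm norm_minus_commute)
  then have "0 \<le> B" using le_B norm_ge_zero order_trans by blast
  have "norm (k z) \<le> B * (2 * r)"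
  proof (rule maximum_modulus_cball[where f = k and a = c and r = r])
    show "continuous_on (cball c r) k"
      unfolding k_def by (rule continuous_on_mult_vanishing_factor[OF cont bounded])
    have "(\<lambda>w. f w * (w - a)) holomorphic_on ball c r" using holo by (intro holomorphic_intros)
    then show "k holomorphic_on ball c r"
      by (rule holomorphic_transform) (use a in \<open>auto simp: k_def\<close>)
    show "norm (k w) \<le> B * (2 * r)" if "w \<in> sphere c r" for w
    proof -
      have "norm (w - a) \<le> 2 * r"
        using dist_triangle[of w a c] that a by (auto simp: dist_norm norm_minus_commute)
      then show ?thesis
        using le_B[of w] that \<open>0 \<le> B\<close> r by (auto simp: k_def norm_mult intro!: mult_mono)
    qed
  qed (use z in simp)
  moreover have "z \<noteq> a" using a z by auto
  ultimately show ?thesis by (simp add: k_def norm_mult)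
qed

text \<open>Applying the weighted bound to \<open>f ^ n\<close> and taking \<open>n\<close>-th roots removes the weight.\<close>

lemma maximum_modulus_cball_except_point:
  fixes f :: "complex \<Rightarrow> complex"
  assumes cont: "continuous_on (cball c r - {a}) f" and holo: "f holomorphic_on ball c r"
    and a: "a \<in> sphere c r" and r: "0 < r"
    and bounded: "\<And>z. z \<in> cball c r - {a} \<Longrightarrow> norm (f z) \<le> M"
    and le_B: "\<And>z. z \<in> sphere c r - {a} \<Longrightarrow> norm (f z) \<le> B" and z: "z \<in> ball c r"
  shows "norm (f z) \<le> B"
proof (rule ccontr)
  have "z \<noteq> a" using a z by auto
  have power_le: "norm (f z) ^ n * norm (z - a) \<le> B ^ n * (2 * r)" for n
    unfolding norm_power[symmetric]
  proof (rule maximum_modulus_cball_weighted[where f = "\<lambda>w. f w ^ n" and M = "M ^ n", OF _ _ a r _ _ z])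
    show "continuous_on (cball c r - {a}) (\<lambda>w. f w ^ n)" "(\<lambda>w. f w ^ n) holomorphic_on ball c r"
      by (intro continuous_intros holomorphic_intros cont holo)+
    show "norm (f w ^ n) \<le> M ^ n" if "w \<in> cball c r - {a}" for w
      unfolding norm_power by (rule power_mono[OF bounded[OF that] norm_ge_zero])
    show "norm (f w ^ n) \<le> B ^ n" if "w \<in> sphere c r - {a}" for w
      unfolding norm_power by (rule power_mono[OF le_B[OF that] norm_ge_zero])
  qed
  have "0 \<le> B ^ 1 * (2 * r)" by (rule order_trans[OF _ power_le[of 1]]) simp
  then have "0 \<le> B" using r by (simp add: zero_le_mult_iff)
  assume "\<not> norm (f z) \<le> B"
  with \<open>0 \<le> B\<close> have fz: "0 < norm (f z)" and ratio: "0 \<le> B / norm (f z)" "B / norm (f z) < 1"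
    by (auto simp: divide_simps)
  have "(\<lambda>n. (B / norm (f z)) ^ n * (2 * r)) \<longlonglongrightarrow> 0 * (2 * r)"
    by (intro tendsto_mult tendsto_const LIMSEQ_realpow_zero ratio)
  moreover have "norm (z - a) \<le> (B / norm (f z)) ^ n * (2 * r)" for n
    using power_le[of n] fz by (simp add: power_divide field_simps)
  ultimately have "norm (z - a) \<le> 0 * (2 * r)"
    by (intro LIMSEQ_le_const) auto
  then show False using \<open>z \<noteq> a\<close> by simp
qed

subsection \<open>Real parts of polynomials on the unit circle\<close>

lemma Re_poly_times_cnj_poly_on_circle:
  "\<exists>r. \<forall>z. norm z = 1 \<longrightarrow> Re (poly p z * cnj (poly q z)) = Re (poly r z)"
proof (induction p q rule: poly_induct2)
  case 0
  show ?case by (intro exI[of _ 0]) simp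
next
  case (pCons a p b q)
  then obtain r where r: "\<And>z. norm z = 1 \<Longrightarrow> Re (poly p z * cnj (poly q z)) = Re (poly r z)" by blast
  have "Re (poly (pCons a p) z * cnj (poly (pCons b q) z))
      = Re (poly (pCons (a * cnj b) (smult (cnj a) q + smult (cnj b) p) + r) z)" if z: "norm z = 1" for z
  proof -
    have unit: "z * cnj z = 1" using z by (simp flip: complex_norm_square)
    have "poly (pCons a p) z * cnj (poly (pCons b q) z)
        = a * cnj b + a * cnj (z * poly q z) + cnj b * (z * poly p z) + (z * cnj z) * (poly p z * cnj (poly q z))"
      by (simp add: algebra_simps)
    moreover have "Re (a * cnj (z * poly q z)) = Re (cnj a * (z * poly q z))"
      by (metis cnj.sel(1) complex_cnj_cnj complex_cnj_mult)
    ultimately have "Re (poly (pCons a p) z * cnj (poly (pCons b q) z))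
        = Re (a * cnj b) + Re (cnj a * (z * poly q z)) + Re (cnj b * (z * poly p z)) + Re (poly r z)"
      unfolding unit by (simp only: mult_1 plus_complex.sel r[OF z])
    then show ?thesis by (simp add: algebra_simps)
  qed
  then show ?case by blast
qed

lemma real_polynomial_function_on_circle:
  fixes f :: "complex \<Rightarrow> real"
  assumes "real_polynomial_function f"
  shows "\<exists>p. \<forall>z. norm z = 1 \<longrightarrow> f z = Re (poly p z)"
  using assms
proof induction
  case (linear f)
  interpret bounded_linear f by fact
  have "f z = Re (poly [:0, Complex (f 1) (- f \<i>):] z)" for z
  proof -
    have "z = Re z *\<^sub>R 1 + Im z *\<^sub>R \<i>" by (simp add: complex_eq_iff)
    then have "f z = Re z * f 1 + Im z * f \<i>" by (metis add scaleR real_scaleR_def)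
    then show ?thesis by simp
  qed
  then show ?case by blast
next
  case (const c)
  show ?case by (intro exI[of _ "[:of_real c:]"]) simp
next
  case (add f g)
  then obtain p q where "\<And>z. norm z = 1 \<Longrightarrow> f z = Re (poly p z)" "\<And>z. norm z = 1 \<Longrightarrow> g z = Re (poly q z)"
    by blast
  then show ?case by (intro exI[of _ "p + q"]) simp
next
  case (mult f g)
  then obtain p q where pq: "\<And>z. norm z = 1 \<Longrightarrow> f z = Re (poly p z)" "\<And>z. norm z = 1 \<Longrightarrow> g z = Re (poly q z)"
    by blast
  obtain r where r: "\<And>z. norm z = 1 \<Longrightarrow> Re (poly p z * cnj (poly q z)) = Re (poly r z)"
    using Re_poly_times_cnj_poly_on_circle by blast
  have "f z * g z = Re (poly (smult (1/2) (p * q + r)) z)" if z: "norm z = 1" for z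
    using pq[OF z] r[OF z] by simp
  then show ?case by blast
qed

lemma norm_mult_exp_minus_le_1_iff: "norm (w * exp (- v)) \<le> 1 \<longleftrightarrow> norm w \<le> exp (Re v)"
  by (simp add: norm_mult) (simp add: exp_minus field_simps)

lemma Re_poly_approximation_on_circle:
  fixes \<phi> :: "complex \<Rightarrow> real"
  assumes "continuous_on (sphere 0 1) \<phi>" and e: "0 < e"
  obtains p where "\<And>z. norm z = 1 \<Longrightarrow> \<phi> z \<le> Re (poly p z)" "\<And>z. norm z = 1 \<Longrightarrow> Re (poly p z) \<le> \<phi> z + e"
proof -
  have "continuous_on (sphere 0 1) (\<lambda>z. \<phi> z + e / 2)" by (intro continuous_intros assms)
  then obtain f where f: "real_polynomial_function f" "\<And>z. norm z = 1 \<Longrightarrow> \<bar>\<phi> z + e / 2 - f z\<bar> < e / 2"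
    using Stone_Weierstrass_real_polynomial_function[of "sphere 0 1" "\<lambda>z. \<phi> z + e / 2" "e / 2"] e by auto
  from f(1) obtain p where p: "\<And>z. norm z = 1 \<Longrightarrow> f z = Re (poly p z)"
    using real_polynomial_function_on_circle by blast
  show ?thesis
  proof (rule that[of p])
    show "\<phi> z \<le> Re (poly p z)" "Re (poly p z) \<le> \<phi> z + e" if "norm z = 1" for z
      using f(2)[OF that] unfolding p[OF that] by linarith+
  qed
qed

lemma continuous_on_circle_cis:
  "continuous_on (sphere 0 1) \<phi> \<Longrightarrow> continuous_on A (\<lambda>t. \<phi> (cis t))"
  by (erule continuous_on_compose2) (auto intro!: continuous_intros)

lemma circle_mean_value:
  fixes f :: "complex \<Rightarrow> complex"
  assumes "continuous_on (cball 0 1) f" "f holomorphic_on ball 0 1"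
  shows "((\<lambda>t. f (cis t)) has_integral 2 * of_real pi * f 0) {0..2*pi}"
proof -
  have "((\<lambda>z. f z / (z - 0)) has_contour_integral (2 * of_real pi * \<i> * f 0)) (circlepath 0 1)"
    using Cauchy_integral_circlepath[OF assms, of 0] by simp
  then have "((\<lambda>t. f (cis t) / cis t * \<i> * cis t) has_integral (2 * of_real pi * \<i> * f 0)) {0..2*pi}"
    unfolding circlepath_def by (subst (asm) has_contour_integral_part_circlepath_iff) simp_all
  from has_integral_divide[OF this, of \<i>] show ?thesis by (simp add: mult_ac)
qed

lemma Re_poly_0_le_circle_mean:
  fixes \<phi> :: "complex \<Rightarrow> real"
  assumes \<phi>: "continuous_on (sphere 0 1) \<phi>" and on_circle: "\<And>z. norm z = 1 \<Longrightarrow> Re (poly p z) \<le> \<phi> z"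
  shows "2 * pi * Re (poly p 0) \<le> integral {0..2*pi} (\<lambda>t. \<phi> (cis t))"
proof (rule has_integral_le)
  show "((\<lambda>t. Re (poly p (cis t))) has_integral 2 * pi * Re (poly p 0)) {0..2*pi}"
    using has_integral_linear[OF circle_mean_value bounded_linear_Re, of "poly p"]
    by (simp add: o_def continuous_intros holomorphic_intros)
  show "((\<lambda>t. \<phi> (cis t)) has_integral integral {0..2*pi} (\<lambda>t. \<phi> (cis t))) {0..2*pi}"
    by (intro integrable_integral integrable_continuous_interval continuous_on_circle_cis \<phi>)
qed (use on_circle in simp)

lemma norm_le_exp_Re_poly_except_point:
  assumes h: "continuous_on (cball 0 1 - {a}) h" "h holomorphic_on ball 0 1" and a: "norm a = 1"
    and bounded: "\<And>z. z \<in> cball 0 1 - {a} \<Longrightarrow> norm (h z) \<le> M"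
    and on_circle: "\<And>z. norm z = 1 \<Longrightarrow> z \<noteq> a \<Longrightarrow> norm (h z) \<le> exp (Re (poly p z))" and z: "norm z < 1"
  shows "norm (h z) \<le> exp (Re (poly p z))"
proof -
  have "bounded ((\<lambda>z. exp (- poly p z)) ` cball 0 1)"
    by (intro compact_imp_bounded compact_continuous_image continuous_intros compact_cball)
  then obtain C where C: "\<And>z. z \<in> cball 0 1 \<Longrightarrow> norm (exp (- poly p z)) \<le> C"
    unfolding bounded_iff by (metis imageI)
  have "norm (h z * exp (- poly p z)) \<le> 1"
  proof (rule maximum_modulus_cball_except_point[where f = "\<lambda>z. h z * exp (- poly p z)" and M = "M * C" and a = a,
        OF _ _ _ zero_less_one])
    show "continuous_on (cball 0 1 - {a}) (\<lambda>z. h z * exp (- poly p z))"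
      "(\<lambda>z. h z * exp (- poly p z)) holomorphic_on ball 0 1"
      by (intro continuous_intros holomorphic_intros h)+
    show "norm (h w * exp (- poly p w)) \<le> M * C" if "w \<in> cball 0 1 - {a}" for w
      unfolding norm_mult using that
      by (intro mult_mono bounded C) (auto intro: order_trans[OF norm_ge_zero bounded])
    show "norm (h w * exp (- poly p w)) \<le> 1" if "w \<in> sphere 0 1 - {a}" for w
      using on_circle[of w] that by (simp only: norm_mult_exp_minus_le_1_iff) simp
  qed (use a z in simp_all)
  then show ?thesis by (simp only: norm_mult_exp_minus_le_1_iff)
qed

lemma norm_le_exp_Re_poly_on_disc:
  assumes h: "continuous_on (cball 0 1) h" "h holomorphic_on ball 0 1"
    and on_circle: "\<And>z. norm z = 1 \<Longrightarrow> norm (h z) \<le> exp (Re (poly p z))" and z: "norm z < 1"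
  shows "norm (h z) \<le> exp (Re (poly p z))"
proof -
  have "bounded (h ` cball 0 1)"
    by (intro compact_imp_bounded compact_continuous_image h compact_cball)
  then obtain M where M: "\<And>z. z \<in> cball 0 1 \<Longrightarrow> norm (h z) \<le> M"
    unfolding bounded_iff by (metis imageI)
  show ?thesis
  proof (rule norm_le_exp_Re_poly_except_point[where a = 1, OF _ h(2) norm_one _ _ z])
    show "continuous_on (cball 0 1 - {1}) h" using h(1) by (rule continuous_on_subset) auto
    show "norm (h w) \<le> M" if "w \<in> cball 0 1 - {1}" for w using M that by simp
  qed (rule on_circle)
qed

lemma Jensen_inequality_majorant:
  fixes h :: "complex \<Rightarrow> complex"
  assumes h: "continuous_on (cball 0 1) h" "h holomorphic_on ball 0 1" "h 0 \<noteq> 0"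
    and \<phi>: "continuous_on (sphere 0 1) \<phi>" and on_circle: "\<And>z. norm z = 1 \<Longrightarrow> norm (h z) \<le> exp (\<phi> z)"
  shows "2 * pi * ln (norm (h 0)) \<le> integral {0..2*pi} (\<lambda>t. \<phi> (cis t))"
proof (rule field_le_epsilon)
  fix e :: real assume "0 < e"
  define d where "d = e / (2 * pi)"
  have "0 < d" using \<open>0 < e\<close> by (simp add: d_def)
  then obtain p where p: "\<And>z. norm z = 1 \<Longrightarrow> \<phi> z \<le> Re (poly p z)" "\<And>z. norm z = 1 \<Longrightarrow> Re (poly p z) \<le> \<phi> z + d"
    using Re_poly_approximation_on_circle[OF \<phi>] by blast
  have "norm (h z) \<le> exp (Re (poly p z))" if "norm z = 1" for z
    using order_trans[OF on_circle] p(1) that by simp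
  then have "norm (h 0) \<le> exp (Re (poly p 0))"
    by (rule norm_le_exp_Re_poly_on_disc[OF h(1,2)]) simp_all
  then have "ln (norm (h 0)) \<le> Re (poly p 0)"
    using h(3) by (metis exp_le_cancel_iff exp_ln zero_less_norm_iff)
  then have "2 * pi * ln (norm (h 0)) \<le> 2 * pi * Re (poly p 0)" by simp
  also have "\<dots> \<le> integral {0..2*pi} (\<lambda>t. \<phi> (cis t) + d)"
    using p(2) by (intro Re_poly_0_le_circle_mean continuous_intros \<phi>)
  also have "\<dots> = integral {0..2*pi} (\<lambda>t. \<phi> (cis t)) + e"
    by (subst Henstock_Kurzweil_Integration.integral_add)
      (auto intro!: integrable_continuous_interval continuous_intros continuous_on_circle_cis \<phi> simp: d_def)
  finally show "2 * pi * ln (norm (h 0)) \<le> integral {0..2*pi} (\<lambda>t. \<phi> (cis t)) + e" .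
qed

text \<open>The majorant is \<open>exp p\<close>, where \<open>Re p\<close> approximates \<open>ln (d + |q|)\<close> on the circle.\<close>

lemma exp_poly_majorant_small_at_boundary_point:
  fixes q :: "complex \<Rightarrow> complex"
  assumes cont: "continuous_on (cball 0 1 - {a}) q" and holo: "q holomorphic_on ball 0 1"
    and a: "norm a = 1" and bounded: "\<And>z. z \<in> cball 0 1 - {a} \<Longrightarrow> norm (q z) \<le> M"
    and lim: "(q \<longlongrightarrow> 0) (at a within sphere 0 1)" and e: "0 < e"
  obtains p where "\<And>z. norm z < 1 \<Longrightarrow> norm (q z) \<le> exp (Re (poly p z))" "exp (Re (poly p a)) < e"
proof -
  define d where "d = e / 3"
  have d: "0 < d" using e by (simp add: d_def)
  then have pos: "0 < d + norm w" for w :: complex by (simp add: add_pos_nonneg)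
  define k where "k = (\<lambda>z. if z = a then 0 else q z)"
  have "continuous_on (sphere 0 1) k"
    unfolding k_def by (rule continuous_on_extend_point[OF continuous_on_subset[OF cont] lim]) auto
  then have "continuous_on (sphere 0 1) (\<lambda>z. ln (d + norm (k z)))"
    using pos by (intro continuous_intros) (auto simp: less_imp_neq[symmetric])
  moreover have "0 < ln (2::real)" by simp
  ultimately obtain p where p: "\<And>z. norm z = 1 \<Longrightarrow> ln (d + norm (k z)) \<le> Re (poly p z)"
    "\<And>z. norm z = 1 \<Longrightarrow> Re (poly p z) \<le> ln (d + norm (k z)) + ln 2"
    using Re_poly_approximation_on_circle by blast
  show ?thesis
  proof (rule that[of p])
    have on_circle: "norm (q w) \<le> exp (Re (poly p w))" if "norm w = 1" "w \<noteq> a" for w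
    proof -
      have "norm (q w) \<le> exp (ln (d + norm (k w)))" using that d by (simp add: k_def exp_ln[OF pos])
      also have "\<dots> \<le> exp (Re (poly p w))" using that p(1) by simp
      finally show ?thesis .
    qed
    show "norm (q z) \<le> exp (Re (poly p z))" if "norm z < 1" for z
      by (rule norm_le_exp_Re_poly_except_point[OF cont holo a bounded on_circle that])
    have "exp (Re (poly p a)) \<le> exp (ln d + ln 2)" using p(2)[OF a] by (simp add: k_def)
    then show "exp (Re (poly p a)) < e" using e d by (simp add: exp_add d_def)
  qed
qed

lemma bounded_holomorphic_limit_at_boundary_point:
  fixes q :: "complex \<Rightarrow> complex"
  assumes cont: "continuous_on (cball 0 1 - {a}) q" and holo: "q holomorphic_on ball 0 1"
    and a: "norm a = 1" and bounded: "\<And>z. z \<in> cball 0 1 - {a} \<Longrightarrow> norm (q z) \<le> M"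
    and lim: "(q \<longlongrightarrow> l) (at a within sphere 0 1)"
  shows "(q \<longlongrightarrow> l) (at a within ball 0 1)"
proof (rule tendstoI)
  fix e :: real assume "0 < e"
  obtain p where p: "\<And>z. norm z < 1 \<Longrightarrow> norm (q z - l) \<le> exp (Re (poly p z))" "exp (Re (poly p a)) < e"
  proof (rule exp_poly_majorant_small_at_boundary_point[OF _ _ a _ LIM_zero[OF lim] \<open>0 < e\<close>])
    show "continuous_on (cball 0 1 - {a}) (\<lambda>z. q z - l)" "(\<lambda>z. q z - l) holomorphic_on ball 0 1"
      by (intro continuous_intros holomorphic_intros cont holo)+
    show "norm (q z - l) \<le> M + norm l" if "z \<in> cball 0 1 - {a}" for z
      using bounded[OF that] norm_triangle_ineq4[of "q z" l] by linarith
  qed blast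
  have "((\<lambda>z. exp (Re (poly p z))) \<longlongrightarrow> exp (Re (poly p a))) (at a within ball 0 1)"
    by (intro tendsto_intros)
  then have "\<forall>\<^sub>F z in at a within ball 0 1. exp (Re (poly p z)) < e"
    using p(2) by (rule order_tendstoD(2))
  moreover have "\<forall>\<^sub>F z in at a within ball 0 1. z \<in> ball 0 1"
    by (simp add: eventually_at_filter)
  ultimately show "\<forall>\<^sub>F z in at a within ball 0 1. dist (q z) l < e"
    by eventually_elim (use p(1) in \<open>force simp: dist_norm\<close>)
qed

subsection \<open>Differentiability of Lipschitz functions almost everywhere\<close>

lemma expanding_imp_strict_mono:
  fixes H :: "real \<Rightarrow> real"
  assumes "0 < K" and "\<And>s t. s \<le> t \<Longrightarrow> K * (t - s) \<le> H t - H s"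
  shows "strict_mono H"
proof (rule strict_monoI)
  fix s t :: real assume "s < t"
  then show "H s < H t" using assms(2)[of s t] mult_pos_pos[of K "t - s"] assms(1) by linarith
qed

lemma expanding_imp_bij:
  fixes H :: "real \<Rightarrow> real"
  assumes K: "0 < K" and lower: "\<And>s t. s \<le> t \<Longrightarrow> K * (t - s) \<le> H t - H s"
    and cont: "continuous_on UNIV H"
  shows "bij H"
proof (rule bijI)
  show "inj H" using expanding_imp_strict_mono[OF K lower] by (rule strict_mono_imp_inj_on)
  have "\<exists>x. H x = y" for y
  proof -
    define n where "n = (\<bar>y\<bar> + \<bar>H 0\<bar>) / K"
    have n: "0 \<le> n" "K * n = \<bar>y\<bar> + \<bar>H 0\<bar>" using K by (auto simp: n_def)
    have "H (-n) \<le> y" using lower[of "-n" 0] n by simp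
    moreover have "y \<le> H n" using lower[of 0 n] n by simp
    ultimately show ?thesis using IVT'[of H "-n" y n] n cont continuous_on_subset by fastforce
  qed
  then show "surj H" by (metis surjI)
qed

text \<open>Pushing Lebesgue measure forward along the inverse of \<open>H\<close> gives the Stieltjes measure of \<open>H\<close>, and
  absolute continuity becomes the fact that Lipschitz images of null sets are null.\<close>

lemma measurable_inv_strict_mono_bij:
  fixes H :: "real \<Rightarrow> real"
  assumes "strict_mono H" "bij H"
  shows "inv H \<in> borel_measurable borel"
proof -
  have "strict_mono (inv H)"
    by (rule strict_mono_inv[OF assms(1) bij_is_surj[OF assms(2)]]) (simp add: bij_is_inj[OF assms(2)])
  then show ?thesis by (intro borel_measurable_mono strict_mono_mono)
qed

lemma emeasure_distr_inv:
  fixes H :: "real \<Rightarrow> real"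
  assumes "strict_mono H" "bij H" "A \<in> sets borel"
  shows "emeasure (distr lborel borel (inv H)) A = emeasure lborel (H ` A)"
  using assms bij_vimage_eq_inv_image[OF bij_imp_bij_inv[OF assms(2)], of A]
  by (simp add: emeasure_distr measurable_inv_strict_mono_bij inv_inv_eq)

lemma absolutely_continuous_distr_inv:
  fixes H :: "real \<Rightarrow> real"
  assumes H: "strict_mono H" "bij H" and lip: "L-lipschitz_on UNIV H"
  shows "absolutely_continuous lborel (distr lborel borel (inv H))"
  unfolding absolutely_continuous_def
proof
  fix A :: "real set" assume null_A: "A \<in> null_sets lborel"
  then have borel_A: "A \<in> sets borel" by auto
  have "negligible A" using null_A by (simp add: negligible_iff_null_sets null_sets_completionI)
  then have "negligible (H ` A)"
    by (rule negligible_locally_Lipschitz_image[rotated])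
      (use lipschitz_onD[OF lip] in \<open>auto simp: dist_norm intro!: exI[of _ UNIV] exI[of _ L]\<close>)
  moreover have "H ` A \<in> sets borel"
    using measurable_sets[OF measurable_inv_strict_mono_bij[OF H] borel_A]
      bij_vimage_eq_inv_image[OF bij_imp_bij_inv[OF H(2)], of A] H(2) by (simp add: inv_inv_eq)
  ultimately have "emeasure lborel (H ` A) = 0"
    by (simp add: negligible_iff_null_sets null_sets_def)
  then show "A \<in> null_sets (distr lborel borel (inv H))"
    using emeasure_distr_inv[OF H borel_A] borel_A by (simp add: null_sets_def)
qed

lemma AE_finite_of_nn_integral_finite_on_intervals:
  assumes f: "f \<in> borel_measurable lborel"
    and finite: "\<And>a b. a \<le> b \<Longrightarrow> (\<integral>\<^sup>+x. f x * indicator {a..b::real} x \<partial>lborel) \<noteq> \<infinity>"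
  shows "AE x in lborel. f x \<noteq> \<infinity>"
proof -
  have "AE x in lborel. \<forall>n::nat. f x * indicator {-real n..real n} x \<noteq> \<infinity>"
    unfolding AE_all_countable
    using f finite by (intro allI nn_integral_PInf_AE) auto
  then show ?thesis
  proof eventually_elim
    case (elim x)
    obtain n :: nat where "\<bar>x\<bar> \<le> real n" using real_arch_simple by blast
    then have "indicator {-real n..real n} x = (1::ennreal)" by (auto simp: indicator_def)
    then show ?case using elim[rule_format, of n] by simp
  qed
qed

lemma Radon_Nikodym_has_integral:
  fixes F :: "real \<Rightarrow> real"
  assumes sets: "sets N = sets borel" and ac: "absolutely_continuous lborel N"
    and N: "\<And>a b. a \<le> b \<Longrightarrow> emeasure N {a..b} = ennreal (F b - F a)"
    and mono: "mono F"
  obtains h where "\<And>a b. a \<le> b \<Longrightarrow> (h has_integral (F b - F a)) {a..b}"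
proof -
  obtain f where f: "f \<in> borel_measurable lborel" "density lborel f = N"
    using sigma_finite_measure.Radon_Nikodym[OF sigma_finite_lborel ac] sets by auto
  have f_interval: "(\<integral>\<^sup>+x. f x * indicator {a..b} x \<partial>lborel) = ennreal (F b - F a)" if "a \<le> b" for a b
    using emeasure_density[of f lborel "{a..b}"] f N[OF that] by simp
  have "AE x in lborel. f x \<noteq> \<infinity>"
    using f(1) f_interval by (intro AE_finite_of_nn_integral_finite_on_intervals) auto
  then have finite: "AE x in lborel. ennreal (enn2real (f x)) = f x"
    by eventually_elim (simp add: less_top)
  have "((\<lambda>x. enn2real (f x)) has_integral (F b - F a)) {a..b}" if "a \<le> b" for a b
  proof -
    have "((\<lambda>x. enn2real (f x) * indicator {a..b} x) has_integral (F b - F a)) UNIV"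
    proof (rule nn_integral_has_integral)
      have "(\<integral>\<^sup>+x. ennreal (enn2real (f x) * indicator {a..b} x) \<partial>lborel) =
            (\<integral>\<^sup>+x. f x * indicator {a..b} x \<partial>lborel)"
        using finite by (intro nn_integral_cong_AE) (auto simp: indicator_def elim!: eventually_mono)
      then show "(\<integral>\<^sup>+x. ennreal (enn2real (f x) * indicator {a..b} x) \<partial>lborel) = ennreal (F b - F a)"
        using f_interval that by simp
    qed (use f monoD[OF mono that] in auto)
    then have "((\<lambda>x. if x \<in> {a..b} then enn2real (f x) else 0) has_integral (F b - F a)) UNIV"
      by (rule has_integral_eq[rotated]) (auto simp: indicator_def)
    then show ?thesis by (simp only: has_integral_restrict_UNIV)
  qed
  then show ?thesis using that by blast
qed

lemma lipschitz_expanding_has_integral: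
  fixes H :: "real \<Rightarrow> real"
  assumes K: "0 < K" and lower: "\<And>s t. s \<le> t \<Longrightarrow> K * (t - s) \<le> H t - H s"
    and lip: "L-lipschitz_on UNIV H"
  obtains h where "\<And>a b. a \<le> b \<Longrightarrow> (h has_integral (H b - H a)) {a..b}"
proof (rule Radon_Nikodym_has_integral)
  have H: "strict_mono H" "bij H"
    by (rule expanding_imp_strict_mono[OF K] expanding_imp_bij[OF K _ lipschitz_on_continuous_on[OF lip]] lower | assumption)+
  show "absolutely_continuous lborel (distr lborel borel (inv H))"
    by (rule absolutely_continuous_distr_inv[OF H lip])
  show "mono H" using H(1) by (rule strict_mono_mono)
  show "emeasure (distr lborel borel (inv H)) {a..b} = ennreal (H b - H a)" if "a \<le> b" for a b
  proof -
    have "H ` {a..b} = {H a..H b}"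
    proof
      show "H ` {a..b} \<subseteq> {H a..H b}" by (auto simp: strict_mono_less_eq[OF H(1)])
      show "{H a..H b} \<subseteq> H ` {a..b}"
        using IVT'[of H a _ b] that continuous_on_subset[OF lipschitz_on_continuous_on[OF lip]] by fastforce
    qed
    then show ?thesis using that by (simp add: emeasure_distr_inv[OF H] strict_mono_less_eq[OF H(1)])
  qed
qed (simp, rule that)

lemma indefinite_integral_AE_right_derivative:
  fixes h H :: "real \<Rightarrow> real"
  assumes h: "\<And>a b. a \<le> b \<Longrightarrow> (h has_integral (H b - H a)) {a..b}"
  shows "AE x in lborel. ((\<lambda>s. (H (x + s) - H x) / s) \<longlongrightarrow> h x) (at_right 0)"
proof -
  have "h integrable_on cbox a b" for a b :: real
    using h[of a b] by (cases "a \<le> b") (auto simp: has_integral_integrable)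
  then obtain N where N: "negligible N"
    "\<And>x e. \<lbrakk>x \<notin> N; 0 < e\<rbrakk> \<Longrightarrow> \<exists>d>0. \<forall>s. 0 < s \<and> s < d \<longrightarrow>
         norm(integral (cbox x (x + s *\<^sub>R One)) h /\<^sub>R s ^ DIM(real) - h x) < e"
    using integrable_ccontinuous_explicit by metis
  have "((\<lambda>s. (H (x + s) - H x) / s) \<longlongrightarrow> h x) (at_right 0)" if "x \<notin> N" for x
  proof (rule tendstoI)
    fix e :: real assume "0 < e"
    then obtain d where d: "d > 0" "\<And>s. 0 < s \<Longrightarrow> s < d \<Longrightarrow>
         norm(integral (cbox x (x + s *\<^sub>R One)) h /\<^sub>R s ^ DIM(real) - h x) < e"
      using N(2)[OF \<open>x \<notin> N\<close>] by metis
    have "dist ((H (x + s) - H x) / s) (h x) < e" if "0 < s" "s < d" for s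
      using d(2)[OF that] integral_unique[OF h[of x "x + s"]] that by (simp add: dist_norm divide_inverse mult.commute)
    then show "\<forall>\<^sub>F s in at_right 0. dist ((H (x + s) - H x) / s) (h x) < e"
      using d(1) by (auto simp: eventually_at_right_field)
  qed
  then have "AE x in lebesgue. ((\<lambda>s. (H (x + s) - H x) / s) \<longlongrightarrow> h x) (at_right 0)"
    using N(1) by (intro AE_I'[of N]) (auto simp: negligible_iff_null_sets)
  then show ?thesis by (simp add: AE_completion_iff)
qed

lemma AE_lborel_uminus:
  assumes "AE x in lborel. P (- x :: real)"
  shows "AE x in lborel. P x"
  using AE_distrD[of uminus lborel borel "\<lambda>x. P (- x)"] assms unfolding lborel_distr_uminus by simp

lemma indefinite_integral_AE_derivative:
  fixes h H :: "real \<Rightarrow> real"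
  assumes h: "\<And>a b. a \<le> b \<Longrightarrow> (h has_integral (H b - H a)) {a..b}"
  shows "AE x in lborel. (H has_real_derivative h x) (at x)"
proof -
  have "((\<lambda>x. h (-x)) has_integral ((\<lambda>x. - H (-x)) b - (\<lambda>x. - H (-x)) a)) {a..b}" if "a \<le> b" for a b
    using h[of "-b" "-a"] that has_integral_reflect_real[of h "H (-a) - H (-b)" "-a" "-b"] by simp
  from indefinite_integral_AE_right_derivative[OF this]
  have "AE x in lborel. ((\<lambda>s. (H (- x + - s) - H (- x)) / - s) \<longlongrightarrow> h (- x)) (at_right 0)"
    by (simp add: minus_divide_left)
  then have "AE x in lborel. ((\<lambda>s. (H (x + - s) - H x) / - s) \<longlongrightarrow> h x) (at_right 0)"
    by (rule AE_lborel_uminus)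
  moreover have "AE x in lborel. ((\<lambda>s. (H (x + s) - H x) / s) \<longlongrightarrow> h x) (at_right 0)"
    by (rule indefinite_integral_AE_right_derivative) (rule h)
  ultimately show ?thesis
  proof eventually_elim
    case (elim x)
    from elim(1) have "((\<lambda>s. (H (x + s) - H x) / s) \<longlongrightarrow> h x) (at_left 0)"
      by (simp add: filterlim_at_left_to_right[of _ _ "0::real"])
    with elim(2) show ?case
      unfolding DERIV_def by (intro filterlim_split_at_real)
  qed
qed

lemma lipschitz_AE_real_derivative:
  fixes G :: "real \<Rightarrow> real"
  assumes lip: "L-lipschitz_on UNIV G"
  shows "AE t in lborel. \<exists>D. (G has_real_derivative D) (at t)"
proof -
  define K where "K = L + 1"
  have "0 \<le> L" using lip by (rule lipschitz_on_nonneg)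
  then have K: "0 < K" by (simp add: K_def)
  have G_diff: "\<bar>G s - G t\<bar> \<le> K * \<bar>s - t\<bar>" for s t
    using lipschitz_onD[OF lip, of s t] by (simp add: dist_real_def K_def distrib_right)
  define H where "H = (\<lambda>t. G t + 2 * K * t)"
  have expanding: "K * (t - s) \<le> H t - H s" if "s \<le> t" for s t
    using G_diff[of s t] that unfolding H_def by (auto simp: algebra_simps abs_if split: if_splits)
  have "(L + 2 * K * 1)-lipschitz_on UNIV H"
    unfolding H_def using K by (intro lipschitz_on_add lip lipschitz_on_cmult_real_nonneg) (auto intro: lipschitz_intros)
  from lipschitz_expanding_has_integral[OF K expanding this]
  obtain h where h: "\<And>a b. a \<le> b \<Longrightarrow> (h has_integral (H b - H a)) {a..b}" by blast
  have "AE t in lborel. (H has_real_derivative h t) (at t)"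
    by (rule indefinite_integral_AE_derivative) (rule h)
  then show ?thesis
  proof eventually_elim
    case (elim t)
    have "((\<lambda>t. H t - 2 * K * t) has_real_derivative (h t - 2 * K)) (at t)"
      by (rule derivative_eq_intros elim refl | simp)+
    then show ?case unfolding H_def by auto
  qed
qed

lemma lipschitz_AE_vector_derivative:
  fixes G :: "real \<Rightarrow> 'a::euclidean_space"
  assumes lip: "L-lipschitz_on UNIV G"
  shows "AE t in lborel. \<exists>D. (G has_vector_derivative D) (at t)"
proof -
  have "AE t in lborel. \<exists>D. ((\<lambda>t. G t \<bullet> b) has_real_derivative D) (at t)" if "b \<in> Basis" for b
  proof (rule lipschitz_AE_real_derivative)
    show "L-lipschitz_on UNIV (\<lambda>t. G t \<bullet> b)"
    proof (rule lipschitz_onI)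
      show "dist (G s \<bullet> b) (G t \<bullet> b) \<le> L * dist s t" for s t
        using Basis_le_norm[OF that, of "G s - G t"] lipschitz_onD[OF lip, of s t]
        by (simp add: dist_norm inner_diff_left)
    qed (rule lipschitz_on_nonneg[OF lip])
  qed
  then have "AE t in lborel. \<forall>b\<in>Basis. \<exists>D. ((\<lambda>t. G t \<bullet> b) has_real_derivative D) (at t)"
    by (simp add: AE_finite_all)
  then show ?thesis
  proof eventually_elim
    case (elim t)
    then obtain D where D: "\<And>b. b \<in> Basis \<Longrightarrow> ((\<lambda>t. G t \<bullet> b) has_real_derivative D b) (at t)" by metis
    have "(G has_vector_derivative (\<Sum>b\<in>Basis. D b *\<^sub>R b)) (at t)"
      unfolding has_vector_derivative_def
      by (subst has_derivative_componentwise_within)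
        (use D in \<open>simp add: has_real_derivative_iff_has_vector_derivative has_vector_derivative_def\<close>)
    then show ?case by blast
  qed
qed

subsection \<open>Radial limits of bounded functions\<close>

definition has_radial_limit :: "(complex \<Rightarrow> complex) \<Rightarrow> real \<Rightarrow> complex \<Rightarrow> bool" where
  "has_radial_limit f t l \<longleftrightarrow> ((\<lambda>\<rho>. f (complex_of_real \<rho> * cis t)) \<longlongrightarrow> l) (at_left 1)"

lemma radial_limit_eq: "has_radial_limit f t l \<Longrightarrow> radial_limit f t = l"
  by (auto simp: has_radial_limit_def radial_limit_def intro!: tendsto_Lim)

lemma has_radial_limit_mult:
  "has_radial_limit f t a \<Longrightarrow> has_radial_limit g t b \<Longrightarrow> has_radial_limit (\<lambda>z. f z * g z) t (a * b)"
  unfolding has_radial_limit_def by (rule tendsto_mult)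

lemma has_radial_limit_unique: "has_radial_limit f t a \<Longrightarrow> has_radial_limit f t b \<Longrightarrow> a = b"
  unfolding has_radial_limit_def by (rule tendsto_unique) simp_all

lemma isCont_has_radial_limit:
  assumes "isCont f (cis t)"
  shows "has_radial_limit f t (f (cis t))"
proof -
  have "((\<lambda>\<rho>. complex_of_real \<rho> * cis t) \<longlongrightarrow> complex_of_real 1 * cis t) (at_left 1)"
    by (intro tendsto_intros)
  then show ?thesis
    unfolding has_radial_limit_def using assms by (intro isCont_tendsto_compose[of "cis t" f]) simp_all
qed

lemma has_radial_limit_cong:
  assumes "has_radial_limit f t l" and "a < 1"
    and "\<And>z. a < norm z \<Longrightarrow> norm z < 1 \<Longrightarrow> f z = g z"
  shows "has_radial_limit g t l"
  unfolding has_radial_limit_def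
proof (rule Lim_transform_eventually)
  show "((\<lambda>\<rho>. f (complex_of_real \<rho> * cis t)) \<longlongrightarrow> l) (at_left 1)"
    using assms(1) by (simp add: has_radial_limit_def)
  have "\<forall>\<^sub>F \<rho> in at_left 1. \<rho> \<in> {max a 0<..<1}"
    using assms(2) by (intro eventually_at_left_real) simp
  then show "\<forall>\<^sub>F \<rho> in at_left 1. f (complex_of_real \<rho> * cis t) = g (complex_of_real \<rho> * cis t)"
    by eventually_elim (rule assms(3), simp_all add: norm_mult)
qed

lemma has_radial_limit_factor:
  assumes "has_radial_limit (\<lambda>z. f z * g z) t b" "has_radial_limit g t a" "a \<noteq> 0"
  shows "has_radial_limit f t (b / a)"
  unfolding has_radial_limit_def
proof (rule Lim_transform_eventually)
  show "((\<lambda>\<rho>. f (complex_of_real \<rho> * cis t) * g (complex_of_real \<rho> * cis t) / g (complex_of_real \<rho> * cis t))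
      \<longlongrightarrow> b / a) (at_left 1)"
    using assms unfolding has_radial_limit_def by (rule tendsto_divide)
  have "\<forall>\<^sub>F \<rho> in at_left 1. g (complex_of_real \<rho> * cis t) \<noteq> 0"
    using assms(2,3) unfolding has_radial_limit_def by (rule tendsto_imp_eventually_ne)
  then show "\<forall>\<^sub>F \<rho> in at_left 1. f (complex_of_real \<rho> * cis t) * g (complex_of_real \<rho> * cis t) / g (complex_of_real \<rho> * cis t)
      = f (complex_of_real \<rho> * cis t)"
    by eventually_elim simp
qed

lemma tendsto_circle_of_tendsto_cis:
  assumes "((\<lambda>s. f (cis s)) \<longlongrightarrow> l) (at t)"
  shows "(f \<longlongrightarrow> l) (at (cis t) within sphere 0 1)"
proof -
  define \<theta> where "\<theta> = (\<lambda>z. t + Arg (z / cis t))"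
  have cis_\<theta>: "cis (\<theta> z) = z" if "norm z = 1" for z
  proof -
    have "z / cis t \<noteq> 0" using that by auto
    then show ?thesis using that by (simp add: \<theta>_def cis_Arg sgn_eq norm_divide flip: cis_mult)
  qed
  have "isCont Arg (cis t / cis t)"
    by (rule continuous_at_Arg) simp
  then have "(\<theta> \<longlongrightarrow> t + Arg (cis t / cis t)) (at (cis t) within sphere 0 1)"
    unfolding \<theta>_def by (intro tendsto_intros isCont_tendsto_compose[where g = Arg]) simp_all
  moreover have "\<theta> z \<noteq> t" if "norm z = 1" "z \<noteq> cis t" for z
    using cis_\<theta>[of z] that by auto
  then have "\<forall>\<^sub>F z in at (cis t) within sphere 0 1. \<theta> z \<noteq> t"
    by (simp add: eventually_at_filter)
  ultimately have "filterlim \<theta> (at t) (at (cis t) within sphere 0 1)"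
    by (simp add: filterlim_at)
  from filterlim_compose[OF assms this]
  have "((\<lambda>z. f (cis (\<theta> z))) \<longlongrightarrow> l) (at (cis t) within sphere 0 1)" .
  then show ?thesis
    by (rule Lim_transform_eventually) (auto simp: eventually_at_filter cis_\<theta>)
qed

lemma has_vector_derivative_imp_tendsto:
  fixes f :: "real \<Rightarrow> 'a::real_normed_vector"
  assumes "(f has_vector_derivative D) (at t)"
  shows "((\<lambda>s. (f s - f t) /\<^sub>R (s - t)) \<longlongrightarrow> D) (at t)"
proof -
  have "((\<lambda>s. norm (f s - f t - (s - t) *\<^sub>R D) / norm (s - t)) \<longlongrightarrow> 0) (at t)"
    using assms by (simp add: has_vector_derivative_def has_derivative_iff_norm)
  moreover have "\<forall>\<^sub>F s in at t. norm (f s - f t - (s - t) *\<^sub>R D) / norm (s - t) = norm ((f s - f t) /\<^sub>R (s - t) - D)"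
    unfolding eventually_at_filter
  proof (rule always_eventually, intro allI impI)
    fix s assume "s \<noteq> t"
    then have "(f s - f t) /\<^sub>R (s - t) - D = (f s - f t - (s - t) *\<^sub>R D) /\<^sub>R (s - t)"
      by (simp add: scaleR_diff_right)
    then show "norm (f s - f t - (s - t) *\<^sub>R D) / norm (s - t) = norm ((f s - f t) /\<^sub>R (s - t) - D)"
      by (simp add: divide_inverse mult.commute)
  qed
  ultimately have "((\<lambda>s. norm ((f s - f t) /\<^sub>R (s - t) - D)) \<longlongrightarrow> 0) (at t)"
    by (rule Lim_transform_eventually)
  then show ?thesis by (simp only: tendsto_norm_zero_iff flip: Lim_null)
qed

lemma difference_quotient_limit_on_circle:
  assumes "((\<lambda>s. H (cis s)) has_vector_derivative D) (at t)"
  shows "((\<lambda>z. (H z - H (cis t)) / (z - cis t)) \<longlongrightarrow> D / (\<i> * cis t)) (at (cis t) within sphere 0 1)"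
proof (rule tendsto_circle_of_tendsto_cis)
  have "(cis has_vector_derivative \<i> * cis t) (at t)"
    by (auto intro!: derivative_eq_intros simp: has_vector_derivative_def)
  from tendsto_divide[OF has_vector_derivative_imp_tendsto[OF assms] has_vector_derivative_imp_tendsto[OF this]]
  have "((\<lambda>s. ((H (cis s) - H (cis t)) /\<^sub>R (s - t)) / ((cis s - cis t) /\<^sub>R (s - t))) \<longlongrightarrow> D / (\<i> * cis t)) (at t)"
    by simp
  then show "((\<lambda>s. (H (cis s) - H (cis t)) / (cis s - cis t)) \<longlongrightarrow> D / (\<i> * cis t)) (at t)"
    by (rule Lim_transform_eventually) (auto simp: eventually_at_filter scaleR_conv_of_real)
qed

lemma norm_deriv_le_near_boundary_point:
  assumes F: "F holomorphic_on ball 0 1" and a: "norm a = 1" and e: "0 < e"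
    and F_le: "\<And>z. norm z < 1 \<Longrightarrow> norm (z - a) < \<delta> \<Longrightarrow> norm (F z) \<le> e * norm (z - a)"
    and \<rho>: "0 < \<rho>" "1 - \<delta> / 2 < \<rho>" "\<rho> < 1"
  shows "norm (deriv F (complex_of_real \<rho> * a)) \<le> 3 * e"
proof -
  define w s where "w = complex_of_real \<rho> * a" and "s = (1 - \<rho>) / 2"
  have s: "0 < s" "3 * s < \<delta>" and w: "norm w = 1 - 2 * s"
    using \<rho> a by (auto simp: s_def w_def norm_mult field_simps)
  have "w - a = complex_of_real (\<rho> - 1) * a" by (simp add: w_def algebra_simps)
  then have norm_w_minus_a: "norm (w - a) = 2 * s" using \<rho> a by (simp only: norm_mult norm_of_real) (simp add: s_def)
  have near_w: "norm z < 1" "norm (z - a) \<le> 3 * s" if "dist w z \<le> s" for z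
    using that w s norm_w_minus_a norm_triangle_ineq[of "z - w" w] norm_triangle_ineq[of "z - w" "w - a"]
    by (auto simp: dist_norm norm_minus_commute)
  have "norm ((deriv ^^ 1) F w) \<le> fact 1 * (3 * e * s) / s ^ 1"
  proof (rule Cauchy_inequality)
    have "F holomorphic_on cball w s"
      using F by (rule holomorphic_on_subset) (use near_w in auto)
    then show "continuous_on (cball w s) F" "F holomorphic_on ball w s"
      by (auto simp: holomorphic_on_imp_continuous_on intro: holomorphic_on_subset)
    show "norm (F z) \<le> 3 * e * s" if "norm (w - z) = s" for z
    proof -
      have z: "norm z < 1" "norm (z - a) \<le> 3 * s" using near_w[of z] that by (simp_all add: dist_norm)
      then have "norm (F z) \<le> e * norm (z - a)" using s by (intro F_le) auto
      also have "\<dots> \<le> e * (3 * s)" using z e by (intro mult_left_mono) auto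
      finally show ?thesis by simp
    qed
  qed (use s in simp)
  then show ?thesis using s by (simp add: w_def)
qed

lemma has_radial_limit_deriv:
  assumes holo: "H holomorphic_on ball 0 1"
    and lim: "((\<lambda>z. (H z - c) / (z - cis t)) \<longlongrightarrow> l) (at (cis t) within ball 0 1)"
  shows "has_radial_limit (deriv H) t l"
  unfolding has_radial_limit_def
proof (rule tendstoI)
  fix e' :: real assume "0 < e'"
  define a where "a = cis t"
  have a: "norm a = 1" by (simp add: a_def)
  define e where "e = e' / 4"
  have e: "0 < e" using \<open>0 < e'\<close> by (simp add: e_def)
  obtain \<delta> where \<delta>: "0 < \<delta>"
    "\<And>z. z \<in> ball 0 1 \<Longrightarrow> z \<noteq> a \<Longrightarrow> dist z a < \<delta> \<Longrightarrow> dist ((H z - c) / (z - a)) l < e"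
    using tendstoD[OF lim e] unfolding eventually_at a_def by auto
  define F where "F = (\<lambda>z. H z - c - l * (z - a))"
  have F_holo: "F holomorphic_on ball 0 1" unfolding F_def by (intro holomorphic_intros holo)
  have F_le: "norm (F z) \<le> e * norm (z - a)" if "norm z < 1" "norm (z - a) < \<delta>" for z
  proof -
    have "z \<noteq> a" using that a by auto
    then have "F z = ((H z - c) / (z - a) - l) * (z - a)" by (simp add: F_def field_simps)
    then show ?thesis using \<delta>(2)[of z] that \<open>z \<noteq> a\<close> by (auto simp: norm_mult dist_norm intro!: mult_right_mono)
  qed
  have deriv_F: "deriv F w = deriv H w - l" if "norm w < 1" for w
  proof (rule DERIV_imp_deriv)
    have "(H has_field_derivative deriv H w) (at w)"
      using holo by (rule holomorphic_derivI) (use that in auto)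
    then show "(F has_field_derivative deriv H w - l) (at w)"
      unfolding F_def by (auto intro!: derivative_eq_intros)
  qed
  have "dist (deriv H (complex_of_real \<rho> * a)) l < e'" if "\<rho> \<in> {max 0 (1 - \<delta> / 2)<..<1}" for \<rho>
    using norm_deriv_le_near_boundary_point[where \<delta> = \<delta> and \<rho> = \<rho>, OF F_holo a e F_le] deriv_F[of "complex_of_real \<rho> * a"] that a e
    by (simp add: dist_norm norm_mult e_def)
  then show "\<forall>\<^sub>F \<rho> in at_left 1. dist (deriv H (complex_of_real \<rho> * cis t)) l < e'"
    unfolding a_def using eventually_at_left_real[of "max 0 (1 - \<delta> / 2)" 1] \<delta>(1) by (auto elim: eventually_mono)
qed

lemma lipschitz_on_cis: "1-lipschitz_on UNIV cis"
proof (rule bounded_derivative_imp_lipschitz[of UNIV cis "\<lambda>x h. h *\<^sub>R (\<i> * cis x)"])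
  show "(cis has_derivative (\<lambda>h. h *\<^sub>R (\<i> * cis x))) (at x within UNIV)" for x
    by (auto intro!: derivative_eq_intros)
  show "onorm (\<lambda>h. h *\<^sub>R (\<i> * cis x)) \<le> 1" for x
    by (rule onorm_le) (simp add: norm_mult)
qed auto

lemma bounded_holomorphic_lipschitz_primitive:
  fixes h :: "complex \<Rightarrow> complex"
  assumes h: "h holomorphic_on ball 0 1" and B: "\<And>z. norm z < 1 \<Longrightarrow> norm (h z) \<le> B"
  obtains H where "B-lipschitz_on (cball 0 1) H" "\<And>z. norm z < 1 \<Longrightarrow> (H has_field_derivative h z) (at z)"
proof -
  obtain P where P: "\<And>z. z \<in> ball 0 1 \<Longrightarrow> (P has_field_derivative h z) (at z within ball 0 1)"
    using holomorphic_convex_primitive'[OF convex_ball open_ball h] by blast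
  have "0 \<le> B" using B[of 0] norm_ge_zero[of "h 0"] by (simp del: norm_ge_zero)
  then have "B-lipschitz_on (ball 0 1) P"
    using field_differentiable_bound[OF convex_ball P, of B] B
    by (intro lipschitz_onI) (auto simp: dist_norm)
  then obtain H where H: "B-lipschitz_on (cball 0 1) H" "\<And>z. z \<in> ball 0 1 \<Longrightarrow> H z = P z"
    using lipschitz_extend_closure[of B "ball 0 1" P] by auto
  have "(H has_field_derivative h z) (at z)" if "z \<in> ball 0 1" for z
  proof -
    have "(P has_field_derivative h z) (at z)"
      using P[OF that] by (simp add: at_within_open[OF that open_ball])
    then show ?thesis
      by (rule has_field_derivative_transform_within_open[OF _ open_ball that]) (simp add: H(2))
  qed
  then show ?thesis using that H(1) by simp
qed

lemma has_radial_limit_of_primitive_derivative: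
  assumes lip: "B-lipschitz_on (cball 0 1) H"
    and H': "\<And>z. norm z < 1 \<Longrightarrow> (H has_field_derivative h z) (at z)"
    and D: "((\<lambda>s. H (cis s)) has_vector_derivative D) (at t)"
  shows "has_radial_limit h t (D / (\<i> * cis t))"
proof -
  have holo: "H holomorphic_on ball 0 1"
    unfolding holomorphic_on_open[OF open_ball] using H' by (metis mem_ball_0)
  define q where "q = (\<lambda>z. (H z - H (cis t)) / (z - cis t))"
  have "(q \<longlongrightarrow> D / (\<i> * cis t)) (at (cis t) within ball 0 1)"
  proof (rule bounded_holomorphic_limit_at_boundary_point)
    show "continuous_on (cball 0 1 - {cis t}) q"
      unfolding q_def using lipschitz_on_continuous_on[OF lip]
      by (intro continuous_intros) (auto intro: continuous_on_subset)
    show "q holomorphic_on ball 0 1"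
      unfolding q_def using holo by (intro holomorphic_intros) auto
    show "norm (q z) \<le> B" if "z \<in> cball 0 1 - {cis t}" for z
      using lipschitz_onD[OF lip, of z "cis t"] that by (simp add: q_def norm_divide dist_norm divide_simps)
    show "(q \<longlongrightarrow> D / (\<i> * cis t)) (at (cis t) within sphere 0 1)"
      unfolding q_def by (rule difference_quotient_limit_on_circle[OF D])
  qed simp
  then have "has_radial_limit (deriv H) t (D / (\<i> * cis t))"
    unfolding q_def by (rule has_radial_limit_deriv[OF holo])
  then show ?thesis
    by (rule has_radial_limit_cong[of _ _ _ 0]) (simp_all add: DERIV_imp_deriv[OF H'])
qed

theorem Fatou_radial_limit_bounded:
  fixes h :: "complex \<Rightarrow> complex"
  assumes "h holomorphic_on ball 0 1" and "\<And>z. norm z < 1 \<Longrightarrow> norm (h z) \<le> B"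
  shows "AE t in lborel. \<exists>l. has_radial_limit h t l"
proof -
  obtain H where lip: "B-lipschitz_on (cball 0 1) H"
    and H': "\<And>z. norm z < 1 \<Longrightarrow> (H has_field_derivative h z) (at z)"
    using bounded_holomorphic_lipschitz_primitive[OF assms] by blast
  have "(B * 1)-lipschitz_on UNIV (H \<circ> cis)"
    by (rule lipschitz_on_compose[OF lipschitz_on_cis lipschitz_on_subset[OF lip]]) auto
  from lipschitz_AE_vector_derivative[OF this] show ?thesis
    by eventually_elim (use has_radial_limit_of_primitive_derivative[OF lip H'] in \<open>auto simp: o_def\<close>)
qed

subsection \<open>Radial limits of Hardy functions\<close>

lemma holomorphic_factor_zero_at:
  assumes f: "f holomorphic_on S" "open S" "connected S" and a: "a \<in> S" and nz: "z0 \<in> S" "f z0 \<noteq> 0"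
  obtains n k where "k holomorphic_on S" "k a \<noteq> 0" "\<And>z. z \<in> S \<Longrightarrow> f z = (z - a) ^ n * k z"
proof (cases "f a = 0")
  case False
  show ?thesis by (rule that[of f 0]) (use f False in auto)
next
  case True
  have "\<not> f constant_on S" unfolding constant_on_def using True a nz by metis
  then obtain g r n where g: "0 < n" "0 < r" "ball a r \<subseteq> S" "g holomorphic_on ball a r"
    "\<And>w. w \<in> ball a r \<Longrightarrow> f w = (w - a) ^ n * g w" "\<And>w. w \<in> ball a r \<Longrightarrow> g w \<noteq> 0"
    using holomorphic_factor_zero_nonconstant[OF f a True] by metis
  define k where "k = (\<lambda>z. if z \<in> ball a r then g z else f z / (z - a) ^ n)"
  have "k holomorphic_on (ball a r \<union> (S - {a}))"
    unfolding k_def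
  proof (rule holomorphic_on_If_Un)
    show "(\<lambda>z. f z / (z - a) ^ n) holomorphic_on S - {a}"
      using f(1) by (intro holomorphic_intros) (auto intro: holomorphic_on_subset)
  qed (use g f in \<open>auto simp: open_delete\<close>)
  moreover have "ball a r \<union> (S - {a}) = S" using g a by auto
  ultimately have "k holomorphic_on S" by simp
  moreover have "k a \<noteq> 0" using g by (simp add: k_def)
  moreover have "f z = (z - a) ^ n * k z" if "z \<in> S" for z
    using g(2,5) by (cases "z = a") (auto simp: k_def)
  ultimately show ?thesis using that by blast
qed

lemma dilation_on_disc:
  assumes "f holomorphic_on ball 0 1" "0 \<le> \<rho>" "\<rho> < 1"
  shows "continuous_on (cball 0 1) (\<lambda>z. f (complex_of_real \<rho> * z))"
    and "(\<lambda>z. f (complex_of_real \<rho> * z)) holomorphic_on ball 0 1"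
proof -
  have "norm (complex_of_real \<rho> * z) < 1" if "norm z \<le> 1" for z
    using mult_left_mono[OF that assms(2)] assms(2,3) by (simp add: norm_mult)
  then have "(\<lambda>z. f (complex_of_real \<rho> * z)) holomorphic_on cball 0 1"
    by (intro holomorphic_on_compose_gen[OF _ assms(1), of "\<lambda>z. complex_of_real \<rho> * z", unfolded o_def])
      (auto intro!: holomorphic_intros)
  then show "continuous_on (cball 0 1) (\<lambda>z. f (complex_of_real \<rho> * z))"
    "(\<lambda>z. f (complex_of_real \<rho> * z)) holomorphic_on ball 0 1"
    by (auto simp: holomorphic_on_imp_continuous_on intro: holomorphic_on_subset)
qed

lemma continuous_on_circle_slice:
  assumes "f holomorphic_on ball 0 1" "0 \<le> \<rho>" "\<rho> < 1"
  shows "continuous_on A (\<lambda>t. f (complex_of_real \<rho> * cis t))"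
  by (intro continuous_on_circle_cis[where \<phi> = "\<lambda>z. f (complex_of_real \<rho> * z)"]
      continuous_on_subset[OF dilation_on_disc(1)[OF assms]]) auto

lemma holomorphic_on_disc_factor_power:
  assumes "f holomorphic_on ball 0 1" "norm z0 < 1" "f z0 \<noteq> 0"
  obtains n k where "k holomorphic_on ball 0 1" "k 0 \<noteq> 0" "\<And>z. norm z < 1 \<Longrightarrow> f z = z ^ n * k z"
  using holomorphic_factor_zero_at[OF assms(1) open_ball connected_ball, of 0 z0] assms(2,3)
  by (metis centre_in_ball diff_zero mem_ball_0 zero_less_one)

lemma ln_circle_mean_ge:
  assumes f: "f holomorphic_on ball 0 1" and k: "k holomorphic_on ball 0 1" "k 0 \<noteq> 0"
    and factor: "\<And>z. norm z < 1 \<Longrightarrow> f z = z ^ n * k z" and \<rho>: "0 < \<rho>" "\<rho> < 1" and e: "0 < e"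
  shows "2 * pi * ln (\<rho> ^ n * norm (k 0)) \<le> integral {0..2*pi} (\<lambda>t. ln (e + norm (f (complex_of_real \<rho> * cis t))))"
proof -
  define h where "h = (\<lambda>z. complex_of_real \<rho> ^ n * k (complex_of_real \<rho> * z))"
  have "\<rho> ^ n * norm (k 0) = norm (h 0)" using \<rho> by (simp add: h_def norm_mult norm_power)
  also have "2 * pi * ln (norm (h 0)) \<le> integral {0..2*pi} (\<lambda>t. ln (e + norm (f (complex_of_real \<rho> * cis t))))"
  proof (rule Jensen_inequality_majorant[where \<phi> = "\<lambda>z. ln (e + norm (f (complex_of_real \<rho> * z)))"])
    show "continuous_on (cball 0 1) h" "h holomorphic_on ball 0 1"
      unfolding h_def using dilation_on_disc[OF k(1), of \<rho>] \<rho> by (auto intro!: continuous_intros holomorphic_intros)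
    show "h 0 \<noteq> 0" using k(2) \<rho> by (simp add: h_def)
    have pos: "0 < e + norm w" for w :: complex using e by (simp add: add_pos_nonneg)
    have "continuous_on (sphere 0 1) (\<lambda>z. f (complex_of_real \<rho> * z))"
      by (rule continuous_on_subset[OF dilation_on_disc(1)[OF f]]) (use \<rho> in auto)
    then show "continuous_on (sphere 0 1) (\<lambda>z. ln (e + norm (f (complex_of_real \<rho> * z))))"
      using pos by (intro continuous_intros) (auto simp: less_imp_neq[symmetric])
    show "norm (h z) \<le> exp (ln (e + norm (f (complex_of_real \<rho> * z))))" if "norm z = 1" for z
    proof -
      have "norm (h z) = norm (f (complex_of_real \<rho> * z))"
        using factor[of "complex_of_real \<rho> * z"] that \<rho>
        by (simp add: h_def norm_mult norm_power power_mult_distrib)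
      then show ?thesis using e by (simp add: exp_ln[OF pos])
    qed
  qed
  finally show ?thesis .
qed

lemma ln_circle_means_bounded_below:
  assumes f: "f holomorphic_on ball 0 1" and nz: "norm z0 < 1" "f z0 \<noteq> 0"
  obtains C where "\<And>\<rho> e. 1/2 \<le> \<rho> \<Longrightarrow> \<rho> < 1 \<Longrightarrow> 0 < e \<Longrightarrow>
    C \<le> integral {0..2*pi} (\<lambda>t. ln (e + norm (f (complex_of_real \<rho> * cis t))))"
proof -
  obtain n k where k: "k holomorphic_on ball 0 1" "k 0 \<noteq> 0" "\<And>z. norm z < 1 \<Longrightarrow> f z = z ^ n * k z"
    using holomorphic_on_disc_factor_power[OF f nz] by blast
  have "2 * pi * ln ((1/2) ^ n * norm (k 0)) \<le> integral {0..2*pi} (\<lambda>t. ln (e + norm (f (complex_of_real \<rho> * cis t))))"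
    if \<rho>: "1/2 \<le> \<rho>" "\<rho> < 1" and e: "0 < e" for \<rho> e :: real
  proof -
    have "(1/2) ^ n * norm (k 0) \<le> \<rho> ^ n * norm (k 0)"
      using \<rho> by (intro mult_right_mono power_mono) auto
    then have "2 * pi * ln ((1/2) ^ n * norm (k 0)) \<le> 2 * pi * ln (\<rho> ^ n * norm (k 0))"
      using k(2) by (intro mult_left_mono ln_mono) auto
    also have "\<dots> \<le> integral {0..2*pi} (\<lambda>t. ln (e + norm (f (complex_of_real \<rho> * cis t))))"
      by (rule ln_circle_mean_ge[OF f k _ \<rho>(2) e]) (use \<rho>(1) in linarith)+
    finally show ?thesis .
  qed
  then show ?thesis using that by blast
qed

lemma nn_integral_continuous_on_interval:
  fixes F :: "real \<Rightarrow> real"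
  assumes cont: "continuous_on {a..b} F" and nonneg: "\<And>t. t \<in> {a..b} \<Longrightarrow> 0 \<le> F t"
  shows "(\<integral>\<^sup>+t. ennreal (indicator {a..b} t *\<^sub>R F t) \<partial>lborel) = ennreal (integral {a..b} F)"
proof (rule nn_integral_has_integral_lborel)
  show "(\<lambda>t. indicator {a..b} t *\<^sub>R F t) \<in> borel_measurable borel"
    by (intro borel_measurable_continuous_on_indicator cont) simp
  show "0 \<le> indicator {a..b} t *\<^sub>R F t" for t
    using nonneg by (simp add: indicator_def)
  have "(F has_integral integral {a..b} F) {a..b}"
    by (intro integrable_integral integrable_continuous_interval cont)
  then show "((\<lambda>t. indicator {a..b} t *\<^sub>R F t) has_integral integral {a..b} F) UNIV"
    by (subst (asm) has_integral_restrict_UNIV[symmetric])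
      (erule has_integral_eq[rotated], simp add: indicator_def)
qed

lemma AE_not_at_top_of_bounded_integrals:
  fixes F :: "nat \<Rightarrow> real \<Rightarrow> real"
  assumes cont: "\<And>n. continuous_on {a..b} (F n)" and nonneg: "\<And>n t. t \<in> {a..b} \<Longrightarrow> 0 \<le> F n t"
    and bound: "\<And>n. integral {a..b} (F n) \<le> C"
  shows "AE t in lborel. t \<in> {a..b} \<longrightarrow> \<not> filterlim (\<lambda>n. F n t) at_top sequentially"
proof -
  define u where "u = (\<lambda>n t. ennreal (indicator {a..b} t *\<^sub>R F n t))"
  have measurable_u: "u n \<in> borel_measurable lborel" for n
    unfolding u_def using borel_measurable_continuous_on_indicator[OF _ cont] by simp
  have int_u: "(\<integral>\<^sup>+t. u n t \<partial>lborel) \<le> ennreal C" for n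
    unfolding u_def using nn_integral_continuous_on_interval[OF cont nonneg] bound by (simp add: ennreal_leI)
  have "(\<integral>\<^sup>+t. liminf (\<lambda>n. u n t) \<partial>lborel) \<le> liminf (\<lambda>n. \<integral>\<^sup>+t. u n t \<partial>lborel)"
    by (rule nn_integral_liminf) (rule measurable_u)
  also have "\<dots> \<le> ennreal C"
    by (rule Liminf_le) (auto intro: always_eventually int_u)
  finally have "(\<integral>\<^sup>+t. liminf (\<lambda>n. u n t) \<partial>lborel) \<noteq> \<infinity>"
    by (metis ennreal_less_top infinity_ennreal_def leD)
  then have "AE t in lborel. liminf (\<lambda>n. u n t) \<noteq> \<infinity>"
    by (intro nn_integral_PInf_AE) (use measurable_u in measurable)
  then show ?thesis
  proof eventually_elim
    case (elim t)
    show ?case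
    proof (intro impI notI)
      assume "t \<in> {a..b}" "filterlim (\<lambda>n. F n t) at_top sequentially"
      then have "(\<lambda>n. u n t) \<longlonglongrightarrow> \<infinity>"
        by (simp add: u_def ennreal_tendsto_top_eq_at_top)
      then have "liminf (\<lambda>n. u n t) = \<infinity>" by (intro lim_imp_Liminf) auto
      with elim show False by simp
    qed
  qed
qed

lemma hardy1_norm_minus_ln_means_bounded:
  assumes hardy: "hardy1 f" and nz: "norm z0 < 1" "f z0 \<noteq> 0"
  obtains C where "\<And>\<rho> e. 1/2 \<le> \<rho> \<Longrightarrow> \<rho> < 1 \<Longrightarrow> 0 < e \<Longrightarrow>
    integral {0..2*pi} (\<lambda>t. norm (f (complex_of_real \<rho> * cis t)) - ln (e + norm (f (complex_of_real \<rho> * cis t)))) \<le> C"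
proof -
  obtain C where f: "f holomorphic_on ball 0 1"
    and C: "\<And>r. 0 < r \<Longrightarrow> r < 1 \<Longrightarrow> integral {0..2*pi} (\<lambda>t. norm (f (complex_of_real r * cis t))) \<le> C"
    using hardy unfolding hardy1_def by blast
  obtain L where L: "\<And>\<rho> e. 1/2 \<le> \<rho> \<Longrightarrow> \<rho> < 1 \<Longrightarrow> 0 < e \<Longrightarrow>
      L \<le> integral {0..2*pi} (\<lambda>t. ln (e + norm (f (complex_of_real \<rho> * cis t))))"
    using ln_circle_means_bounded_below[OF f nz] by blast
  have "integral {0..2*pi} (\<lambda>t. norm (f (complex_of_real \<rho> * cis t)) - ln (e + norm (f (complex_of_real \<rho> * cis t)))) \<le> C - L"
    if \<rho>: "1/2 \<le> \<rho>" "\<rho> < 1" and e: "0 < e" for \<rho> e :: real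
  proof -
    have \<rho>_pos: "0 < \<rho>" using \<rho> by linarith
    have "e + norm w \<noteq> 0" for w :: complex using e norm_ge_zero[of w] by linarith
    then have "integral {0..2*pi} (\<lambda>t. norm (f (complex_of_real \<rho> * cis t)) - ln (e + norm (f (complex_of_real \<rho> * cis t))))
        = integral {0..2*pi} (\<lambda>t. norm (f (complex_of_real \<rho> * cis t)))
          - integral {0..2*pi} (\<lambda>t. ln (e + norm (f (complex_of_real \<rho> * cis t))))"
      using \<rho> \<rho>_pos
      by (intro Henstock_Kurzweil_Integration.integral_diff integrable_continuous_interval
          continuous_intros continuous_on_circle_slice[OF f]) auto
    with C[OF \<rho>_pos \<rho>(2)] L[OF \<rho> e] show ?thesis by linarith
  qed
  then show ?thesis using that by blast
qed

lemma filterlim_minus_ln_at_top: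
  fixes a e :: "nat \<Rightarrow> real"
  assumes a: "a \<longlonglongrightarrow> 0" and e: "e \<longlonglongrightarrow> 0" and pos: "\<And>n. 0 < e n + a n"
  shows "filterlim (\<lambda>n. a n - ln (e n + a n)) at_top sequentially"
proof -
  have "filterlim (\<lambda>n. e n + a n) (at_right 0) sequentially"
    using tendsto_add[OF e a] pos by (simp add: filterlim_at less_imp_neq[symmetric])
  then have "filterlim (\<lambda>n. ln (e n + a n)) at_bot sequentially"
    by (rule filterlim_compose[OF ln_at_0])
  then have "filterlim (\<lambda>n. a n + - ln (e n + a n)) at_top sequentially"
    by (intro filterlim_tendsto_add_at_top[OF a]) (simp add: filterlim_uminus_at_bot)
  then show ?thesis by simp
qed

text \<open>The nonnegative functions \<open>|f| - ln (e + |f|)\<close> have bounded circle means, so they cannot tend to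
  infinity on a set of positive measure.\<close>

theorem hardy1_not_has_radial_limit_0:
  assumes hardy: "hardy1 f" and nz: "norm z0 < 1" "f z0 \<noteq> 0"
  shows "AE t in lborel. t \<in> {0..2*pi} \<longrightarrow> \<not> has_radial_limit f t 0"
proof -
  have f: "f holomorphic_on ball 0 1" using hardy by (simp add: hardy1_def)
  obtain C where C: "\<And>\<rho> e. 1/2 \<le> \<rho> \<Longrightarrow> \<rho> < 1 \<Longrightarrow> 0 < e \<Longrightarrow> integral {0..2*pi}
      (\<lambda>t. norm (f (complex_of_real \<rho> * cis t)) - ln (e + norm (f (complex_of_real \<rho> * cis t)))) \<le> C"
    using hardy1_norm_minus_ln_means_bounded[OF hardy nz] by blast
  define e \<rho> where "e = (\<lambda>n. 1 / (real n + 2))" and "\<rho> = (\<lambda>n. 1 - 1 / (real n + 2))"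
  have e: "0 < e n" "e n < 1" and \<rho>: "1/2 \<le> \<rho> n" "\<rho> n < 1" "0 \<le> \<rho> n" for n
    by (auto simp: e_def \<rho>_def field_simps)
  have lim_e: "e \<longlonglongrightarrow> 0" and lim_\<rho>: "filterlim \<rho> (at_left 1) sequentially"
    unfolding e_def \<rho>_def by real_asymp+
  define a where "a = (\<lambda>n t. norm (f (complex_of_real (\<rho> n) * cis t)))"
  have pos: "0 < e n + a n t" for n t using e by (simp add: a_def add_pos_nonneg)
  have "AE t in lborel. t \<in> {0..2*pi} \<longrightarrow> \<not> filterlim (\<lambda>n. a n t - ln (e n + a n t)) at_top sequentially"
  proof (rule AE_not_at_top_of_bounded_integrals)
    show "continuous_on {0..2*pi} (\<lambda>t. a n t - ln (e n + a n t))" for n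
      using pos \<rho> unfolding a_def
      by (intro continuous_intros continuous_on_circle_slice[OF f]) (auto simp: less_imp_neq[symmetric])
    show "0 \<le> a n t - ln (e n + a n t)" for n t
      using ln_le_minus_one[OF pos[of n t]] e(2)[of n] by simp
    show "integral {0..2*pi} (\<lambda>t. a n t - ln (e n + a n t)) \<le> C" for n
      unfolding a_def by (rule C[OF \<rho>(1,2) e(1)])
  qed
  then show ?thesis
  proof eventually_elim
    case (elim t)
    have "filterlim (\<lambda>n. a n t - ln (e n + a n t)) at_top sequentially" if "has_radial_limit f t 0"
    proof -
      have "(\<lambda>n. f (complex_of_real (\<rho> n) * cis t)) \<longlonglongrightarrow> 0"
        using filterlim_compose[OF that[unfolded has_radial_limit_def] lim_\<rho>] .
      then have "(\<lambda>n. a n t) \<longlonglongrightarrow> 0"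
        unfolding a_def by (rule tendsto_norm_zero)
      then show ?thesis using lim_e pos by (rule filterlim_minus_ln_at_top)
    qed
    with elim show ?case by blast
  qed
qed

lemma exp_poly_majorant:
  fixes f :: "complex \<Rightarrow> complex"
  assumes f: "continuous_on (sphere 0 1) f"
  obtains p where "\<And>z. norm z = 1 \<Longrightarrow> 1 + norm (f z) \<le> exp (Re (poly p z))"
    "Re (poly p 0) \<le> 1 + integral {0..2*pi} (\<lambda>t. norm (f (cis t))) / (2 * pi)"
proof -
  have pos: "0 < 1 + norm w" for w :: complex by (simp add: add_pos_nonneg)
  have "continuous_on (sphere 0 1) (\<lambda>z. ln (1 + norm (f z)))"
    using pos by (intro continuous_intros f) (auto simp: less_imp_neq[symmetric])
  then obtain p where p: "\<And>z. norm z = 1 \<Longrightarrow> ln (1 + norm (f z)) \<le> Re (poly p z)"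
    "\<And>z. norm z = 1 \<Longrightarrow> Re (poly p z) \<le> ln (1 + norm (f z)) + 1"
    using Re_poly_approximation_on_circle[OF _ zero_less_one] by blast
  show ?thesis
  proof (rule that[of p])
    show "1 + norm (f z) \<le> exp (Re (poly p z))" if "norm z = 1" for z
      using p(1)[OF that] pos[of "f z"] by (metis exp_le_cancel_iff exp_ln)
    have "2 * pi * Re (poly p 0) \<le> integral {0..2*pi} (\<lambda>t. 1 + norm (f (cis t)))"
    proof (rule Re_poly_0_le_circle_mean[where \<phi> = "\<lambda>z. 1 + norm (f z)"])
      show "continuous_on (sphere 0 1) (\<lambda>z. 1 + norm (f z))" by (intro continuous_intros f)
      show "Re (poly p z) \<le> 1 + norm (f z)" if "norm z = 1" for z
        using p(2)[OF that] ln_le_minus_one[OF pos[of "f z"]] by simp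
    qed
    also have "\<dots> = 2 * pi + integral {0..2*pi} (\<lambda>t. norm (f (cis t)))"
      using f by (subst Henstock_Kurzweil_Integration.integral_add)
        (auto intro!: integrable_continuous_interval continuous_intros continuous_on_circle_cis)
    finally show "Re (poly p 0) \<le> 1 + integral {0..2*pi} (\<lambda>t. norm (f (cis t))) / (2 * pi)"
      by (simp add: field_simps)
  qed
qed

lemma exists_bounding_multiplier:
  fixes f :: "complex \<Rightarrow> complex"
  assumes cont: "continuous_on (cball 0 1) f" and holo: "f holomorphic_on ball 0 1"
  obtains v where "v holomorphic_on ball 0 1" "\<And>z. norm z < 1 \<Longrightarrow> norm (v z) \<le> 1"
    "\<And>z. norm z < 1 \<Longrightarrow> norm (f z * v z) \<le> 1"
    "exp (- (1 + integral {0..2*pi} (\<lambda>t. norm (f (cis t))) / (2 * pi))) \<le> norm (v 0)"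
proof -
  have "continuous_on (sphere 0 1) f" using cont by (rule continuous_on_subset) auto
  then obtain p where p: "\<And>z. norm z = 1 \<Longrightarrow> 1 + norm (f z) \<le> exp (Re (poly p z))"
    "Re (poly p 0) \<le> 1 + integral {0..2*pi} (\<lambda>t. norm (f (cis t))) / (2 * pi)"
    using exp_poly_majorant by blast
  have on_circle: "1 \<le> exp (Re (poly p z))" "norm (f z) \<le> exp (Re (poly p z))" if "norm z = 1" for z
    using p(1)[OF that] norm_ge_zero[of "f z"] by linarith+
  show ?thesis
  proof (rule that[of "\<lambda>z. exp (- poly p z)"])
    show "(\<lambda>z. exp (- poly p z)) holomorphic_on ball 0 1"
      by (intro holomorphic_intros)
    show "norm (exp (- poly p z)) \<le> 1" if z: "norm z < 1" for z
    proof -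
      have "norm (1::complex) \<le> exp (Re (poly p z))"
        by (rule norm_le_exp_Re_poly_on_disc[where h = "\<lambda>_. 1"]) (use on_circle z in simp_all)
      then show ?thesis by simp
    qed
    show "norm (f z * exp (- poly p z)) \<le> 1" if z: "norm z < 1" for z
      unfolding norm_mult_exp_minus_le_1_iff
      by (rule norm_le_exp_Re_poly_on_disc[OF cont holo on_circle(2)]) (use z in simp_all)
    show "exp (- (1 + integral {0..2*pi} (\<lambda>t. norm (f (cis t))) / (2 * pi))) \<le> norm (exp (- poly p 0))"
      using p(2) by simp
  qed
qed

lemma hardy1_of_bounded:
  assumes h: "h holomorphic_on ball 0 1" and B: "\<And>z. norm z < 1 \<Longrightarrow> norm (h z) \<le> B"
  shows "hardy1 h"
  unfolding hardy1_def
proof (intro conjI h exI allI impI)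
  fix r :: real assume r: "0 < r \<and> r < 1"
  have "integral {0..2*pi} (\<lambda>t. norm (h (complex_of_real r * cis t))) \<le> integral {0..2*pi} (\<lambda>t. B)"
    using r by (intro integral_le integrable_continuous_interval continuous_intros continuous_on_circle_slice[OF h] B)
      (auto simp: norm_mult)
  then show "integral {0..2*pi} (\<lambda>t. norm (h (complex_of_real r * cis t))) \<le> 2 * pi * B" by simp
qed

lemma hardy1_dilation_multipliers:
  assumes "hardy1 f"
  obtains m where "0 < m" "\<And>\<rho>. 0 < \<rho> \<Longrightarrow> \<rho> < 1 \<Longrightarrow> \<exists>v. v holomorphic_on ball 0 1 \<and> m \<le> norm (v 0) \<and>
    (\<forall>z. norm z < 1 \<longrightarrow> norm (v z) \<le> 1 \<and> norm (f (complex_of_real \<rho> * z) * v z) \<le> 1)"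
proof -
  obtain C where f: "f holomorphic_on ball 0 1"
    and C: "\<And>r. 0 < r \<Longrightarrow> r < 1 \<Longrightarrow> integral {0..2*pi} (\<lambda>t. norm (f (complex_of_real r * cis t))) \<le> C"
    using assms unfolding hardy1_def by blast
  define m where "m = exp (- (1 + C / (2 * pi)))"
  have "\<exists>v. v holomorphic_on ball 0 1 \<and> m \<le> norm (v 0) \<and>
      (\<forall>z. norm z < 1 \<longrightarrow> norm (v z) \<le> 1 \<and> norm (f (complex_of_real \<rho> * z) * v z) \<le> 1)"
    if \<rho>: "0 < \<rho>" "\<rho> < 1" for \<rho>
  proof -
    obtain v where v: "v holomorphic_on ball 0 1" "\<And>z. norm z < 1 \<Longrightarrow> norm (v z) \<le> 1"
      "\<And>z. norm z < 1 \<Longrightarrow> norm (f (complex_of_real \<rho> * z) * v z) \<le> 1"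
      "exp (- (1 + integral {0..2*pi} (\<lambda>t. norm (f (complex_of_real \<rho> * cis t))) / (2 * pi))) \<le> norm (v 0)"
      using exists_bounding_multiplier[OF dilation_on_disc[OF f less_imp_le]] \<rho> by metis
    have "m \<le> norm (v 0)"
      using C[OF \<rho>] by (intro order_trans[OF _ v(4)]) (simp add: m_def divide_right_mono)
    with v show ?thesis by blast
  qed
  then show ?thesis using that[of m] by (simp add: m_def)
qed

lemma LIMSEQ_dilation:
  assumes f: "f holomorphic_on ball 0 1" and \<rho>: "\<rho> \<longlonglongrightarrow> 1" and z: "norm z < 1"
  shows "(\<lambda>n. f (complex_of_real (\<rho> n) * z)) \<longlonglongrightarrow> f z"
proof -
  have "(\<lambda>n. complex_of_real (\<rho> n) * z) \<longlonglongrightarrow> complex_of_real 1 * z"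
    by (intro tendsto_intros \<rho>)
  moreover have "isCont f z"
    using holomorphic_on_imp_continuous_on[OF f] z by (simp add: continuous_on_eq_continuous_at)
  ultimately show ?thesis
    by (intro isCont_tendsto_compose[where g = f]) simp_all
qed

text \<open>A limit of the multipliers of the dilations, by Montel's theorem; the lower bound at the origin keeps
  it from vanishing.\<close>

theorem hardy1_bounded_multiplier:
  assumes "hardy1 f"
  obtains v where "v holomorphic_on ball 0 1" "\<And>z. norm z < 1 \<Longrightarrow> norm (v z) \<le> 1"
    "\<And>z. norm z < 1 \<Longrightarrow> norm (f z * v z) \<le> 1" "v 0 \<noteq> 0"
proof -
  have f: "f holomorphic_on ball 0 1" using assms by (simp add: hardy1_def)
  define \<rho> where "\<rho> = (\<lambda>n::nat. 1 - 1 / (real n + 2))"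
  have \<rho>: "0 < \<rho> n" "\<rho> n < 1" for n by (auto simp: \<rho>_def field_simps)
  have lim_\<rho>: "\<rho> \<longlonglongrightarrow> 1" unfolding \<rho>_def by real_asymp
  obtain m where "0 < m" and m: "\<And>n. \<exists>v. v holomorphic_on ball 0 1 \<and> m \<le> norm (v 0) \<and>
      (\<forall>z. norm z < 1 \<longrightarrow> norm (v z) \<le> 1 \<and> norm (f (complex_of_real (\<rho> n) * z) * v z) \<le> 1)"
    using hardy1_dilation_multipliers[OF assms] \<rho> by metis
  obtain V where V: "\<And>n. V n holomorphic_on ball 0 1" "\<And>n. m \<le> norm (V n 0)"
    "\<And>n z. norm z < 1 \<Longrightarrow> norm (V n z) \<le> 1"
    "\<And>n z. norm z < 1 \<Longrightarrow> norm (f (complex_of_real (\<rho> n) * z) * V n z) \<le> 1"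
    using m by metis
  obtain v a where v: "v holomorphic_on ball 0 1" and a: "strict_mono (a :: nat \<Rightarrow> nat)"
    and lim_V: "\<And>z. z \<in> ball 0 1 \<Longrightarrow> (\<lambda>n. V (a n) z) \<longlonglongrightarrow> v z"
  proof (rule Montel[of "ball 0 1" "range V" V])
    show "\<exists>B. \<forall>h\<in>range V. \<forall>z\<in>K. norm (h z) \<le> B" if "K \<subseteq> ball 0 1" for K
      using that V(3) by (intro exI[of _ 1]) auto
  qed (use V(1) in auto)
  show ?thesis
  proof (rule that[OF v])
    show "norm (v z) \<le> 1" if "norm z < 1" for z
      by (rule Lim_norm_ubound[OF _ lim_V]) (use V(3) that in auto)
    show "norm (f z * v z) \<le> 1" if z: "norm z < 1" for z
    proof -
      have "(\<lambda>n. f (complex_of_real (\<rho> (a n)) * z)) \<longlonglongrightarrow> f z"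
        by (intro LIMSEQ_dilation[OF f _ z] filterlim_compose[OF lim_\<rho> filterlim_subseq[OF a]])
      then have "(\<lambda>n. f (complex_of_real (\<rho> (a n)) * z) * V (a n) z) \<longlonglongrightarrow> f z * v z"
        using lim_V[of z] z by (intro tendsto_mult) simp_all
      then show ?thesis by (rule Lim_norm_ubound[rotated]) (use V(4) z in auto)
    qed
    have "m \<le> norm (v 0)"
      using tendsto_norm[OF lim_V[of 0]] V(2) by (intro LIMSEQ_le_const) auto
    then show "v 0 \<noteq> 0" using \<open>0 < m\<close> by auto
  qed
qed

theorem hardy1_AE_nonzero_radial_limit:
  assumes f: "hardy1 f" and nz: "norm z0 < 1" "f z0 \<noteq> 0"
  shows "AE t in lborel. t \<in> {0..2*pi} \<longrightarrow> (\<exists>l. l \<noteq> 0 \<and> has_radial_limit f t l)"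
proof -
  obtain v where v: "v holomorphic_on ball 0 1" "\<And>z. norm z < 1 \<Longrightarrow> norm (v z) \<le> 1"
    and fv: "\<And>z. norm z < 1 \<Longrightarrow> norm (f z * v z) \<le> 1" and v0: "v 0 \<noteq> 0"
    using hardy1_bounded_multiplier[OF f] by blast
  have "(\<lambda>z. f z * v z) holomorphic_on ball 0 1"
    using f v(1) unfolding hardy1_def by (intro holomorphic_intros) auto
  from Fatou_radial_limit_bounded[OF v] Fatou_radial_limit_bounded[OF this fv]
    hardy1_not_has_radial_limit_0[OF hardy1_of_bounded[OF v], of 0] hardy1_not_has_radial_limit_0[OF f nz]
  have "AE t in lborel. \<exists>a. has_radial_limit v t a" "AE t in lborel. \<exists>b. has_radial_limit (\<lambda>z. f z * v z) t b"
    "AE t in lborel. t \<in> {0..2*pi} \<longrightarrow> \<not> has_radial_limit v t 0"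
    "AE t in lborel. t \<in> {0..2*pi} \<longrightarrow> \<not> has_radial_limit f t 0"
    using v0 by simp_all
  then show ?thesis
    by eventually_elim (metis has_radial_limit_factor)
qed

lemma norm_eq_at_boundary_of_radial_limits:
  assumes f: "has_radial_limit f t a" and g: "has_radial_limit g t b" and ab: "norm a = norm b" "a \<noteq> 0"
    and "isCont P (cis t)" "isCont Q (cis t)" and "s < 1"
    and identity: "\<And>z. s < norm z \<Longrightarrow> norm z < 1 \<Longrightarrow> f z * Q z = g z * P z"
  shows "norm (P (cis t)) = norm (Q (cis t))"
proof -
  have "has_radial_limit (\<lambda>z. f z * Q z) t (a * Q (cis t))" "has_radial_limit (\<lambda>z. g z * P z) t (b * P (cis t))"
    using f g assms(5,6) by (simp_all add: has_radial_limit_mult isCont_has_radial_limit)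
  then have "a * Q (cis t) = b * P (cis t)"
    using has_radial_limit_cong[where g = "\<lambda>z. g z * P z", OF _ \<open>s < 1\<close> identity] has_radial_limit_unique by blast
  then have "norm a * norm (Q (cis t)) = norm b * norm (P (cis t))" by (metis norm_mult)
  then show ?thesis using ab by (cases "b = 0") auto
qed

lemma infinite_on_circle_of_AE:
  assumes "AE t in lborel. t \<in> {0..2*pi} \<longrightarrow> R (cis t)"
  shows "infinite {z \<in> sphere 0 1. R z}"
proof
  assume fin: "finite {z \<in> sphere 0 1. R z}"
  define T where "T = {t \<in> {0..pi}. R (cis t)}"
  have "inj_on cis T"
    by (rule inj_onI) (metis (mono_tags, lifting) T_def atLeastAtMost_iff cis.sel(1) cos_inj_pi mem_Collect_eq)
  moreover have "cis ` T \<subseteq> {z \<in> sphere 0 1. R z}" by (auto simp: T_def)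
  ultimately have "finite T" using fin by (meson finite_imageD finite_subset)
  then have "AE t in lborel. t \<notin> T" by (intro AE_not_in finite_imp_null_set_lborel)
  with assms have "AE t in lborel. t \<notin> {0..pi}"
    by eventually_elim (auto simp: T_def)
  then have "{0..pi} \<in> null_sets lborel" by (subst AE_iff_null_sets) auto
  then show False using pi_gt_zero by (auto simp: null_sets_def ennreal_eq_0_iff)
qed

subsection \<open>Reflection in circles\<close>

lemma holomorphic_eq_0_of_infinite_zeros:
  assumes f: "f holomorphic_on S" "open S" "connected S" and K: "compact K" "K \<subseteq> S"
    and X: "X \<subseteq> K" "infinite X" "\<And>z. z \<in> X \<Longrightarrow> f z = 0" and z: "z \<in> S"
  shows "f z = 0"
proof (cases "f constant_on S")
  case True
  obtain x where "x \<in> X" using X(2) by (metis ex_in_conv finite.emptyI)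
  then show ?thesis using True X K z unfolding constant_on_def by (metis subsetD)
next
  case False
  have "X \<subseteq> {z \<in> K. f z = 0}" using X by auto
  then show ?thesis
    using holomorphic_compact_finite_zeros[OF f K False] X(2) finite_subset by blast
qed

lemma infinite_nonzeros:
  assumes f: "f holomorphic_on S" "open S" "connected S" and K: "compact K" "K \<subseteq> S"
    and X: "X \<subseteq> K" "infinite X" and nz: "z0 \<in> S" "f z0 \<noteq> 0"
  shows "infinite {w \<in> X. f w \<noteq> 0}"
proof
  assume "finite {w \<in> X. f w \<noteq> 0}"
  moreover have "X = {w \<in> X. f w \<noteq> 0} \<union> {w \<in> X. f w = 0}" by auto
  ultimately have "infinite {w \<in> X. f w = 0}" using X(2) by (metis finite_UnI)
  then have "f z0 = 0"
    by (rule holomorphic_eq_0_of_infinite_zeros[OF f K, rotated]) (use X(1) nz(1) in auto)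
  with nz(2) show False ..
qed

definition annulus :: "real \<Rightarrow> real \<Rightarrow> complex set" where
  "annulus a b = {z. a < norm z \<and> norm z < b}"

lemma open_annulus: "open (annulus a b)"
proof -
  have "annulus a b = ball 0 b - cball 0 a" by (auto simp: annulus_def)
  then show ?thesis by (simp add: open_Diff)
qed

lemma connected_annulus_0: "connected (annulus a b)"
  using connected_annulus(1)[of a "0::complex" b] by (simp add: annulus_def)

definition circle_reflection :: "real \<Rightarrow> complex \<Rightarrow> complex" where
  "circle_reflection \<rho> z = complex_of_real (\<rho>\<^sup>2) / cnj z"

lemma circle_reflection_on_circle:
  assumes "norm z = \<rho>"
  shows "circle_reflection \<rho> z = z"
  using assms by (cases "z = 0") (auto simp: circle_reflection_def complex_norm_square simp del: of_real_power)

lemma norm_circle_reflection: "norm (circle_reflection \<rho> z) = \<rho>\<^sup>2 / norm z"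
  by (simp add: circle_reflection_def norm_divide norm_power)

lemma circle_reflection_annulus:
  assumes "z \<in> annulus a b" "0 < a" "a * b = \<rho>\<^sup>2"
  shows "circle_reflection \<rho> z \<in> annulus a b"
proof -
  have z: "0 < norm z" "a < norm z" "norm z < b" using assms(1,2) by (auto simp: annulus_def)
  then have "0 < b" using assms(2) by linarith
  then have "a * norm z < a * b" "a * b < b * norm z" using z assms(2) by simp_all
  then show ?thesis using z(1) by (simp add: annulus_def norm_circle_reflection less_divide_eq divide_less_eq flip: assms(3))
qed

definition reflected :: "real \<Rightarrow> (complex \<Rightarrow> complex) \<Rightarrow> complex \<Rightarrow> complex" where
  "reflected \<rho> h z = cnj (h (circle_reflection \<rho> z))"

lemma holomorphic_on_reflected:
  assumes h: "h holomorphic_on S" "open S" and T: "0 \<notin> T" "circle_reflection \<rho> ` T \<subseteq> S"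
  shows "reflected \<rho> h holomorphic_on T"
  unfolding holomorphic_on_def
proof
  fix z assume z: "z \<in> T"
  define w where "w = complex_of_real (\<rho>\<^sup>2) / z"
  have "cnj w \<in> S" using T z by (auto simp: w_def circle_reflection_def)
  then have "h field_differentiable at (cnj w)"
    using h holomorphic_on_imp_differentiable_at by blast
  then have outer: "(cnj \<circ> h \<circ> cnj) field_differentiable at w"
    by (rule field_differentiable_cnj_cnj)
  have "(\<lambda>z. complex_of_real (\<rho>\<^sup>2) / z) field_differentiable at z"
    using T z by (intro derivative_intros) auto
  from field_differentiable_compose[OF this outer[unfolded w_def]]
  have "((cnj \<circ> h \<circ> cnj) \<circ> (\<lambda>z. complex_of_real (\<rho>\<^sup>2) / z)) field_differentiable at z" .
  moreover have "(cnj \<circ> h \<circ> cnj) \<circ> (\<lambda>z. complex_of_real (\<rho>\<^sup>2) / z) = reflected \<rho> h"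
    by (auto simp: reflected_def circle_reflection_def)
  ultimately show "reflected \<rho> h field_differentiable at z within T"
    by (simp add: field_differentiable_at_within)
qed

lemma reflected_1_reflected: "z \<noteq> 0 \<Longrightarrow> reflected 1 (reflected \<rho> h) z = h (complex_of_real (\<rho>\<^sup>2) * z)"
  by (simp add: reflected_def circle_reflection_def)

text \<open>On the circle of radius \<open>\<rho>\<close>, both sides are the squared moduli.\<close>

lemma equal_norm_imp_reflected_identity:
  assumes f: "f holomorphic_on annulus a b" and g: "g holomorphic_on annulus a b"
    and ab: "0 < a" "a * b = \<rho>\<^sup>2" "a < \<rho>" "\<rho> < b"
    and X: "X \<subseteq> sphere 0 \<rho>" "infinite X" and equal_norm: "\<And>z. z \<in> X \<Longrightarrow> norm (f z) = norm (g z)"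
    and z: "z \<in> annulus a b"
  shows "f z * reflected \<rho> f z = g z * reflected \<rho> g z"
proof -
  have "circle_reflection \<rho> ` annulus a b \<subseteq> annulus a b" "0 \<notin> annulus a b"
    using circle_reflection_annulus ab by (auto simp: annulus_def)
  then have refl: "reflected \<rho> h holomorphic_on annulus a b" if "h holomorphic_on annulus a b" for h
    using holomorphic_on_reflected[OF that open_annulus] by blast
  have "f z * reflected \<rho> f z - g z * reflected \<rho> g z = 0"
  proof (rule holomorphic_eq_0_of_infinite_zeros[OF _ open_annulus connected_annulus_0 compact_sphere _ X _ z])
    show "(\<lambda>z. f z * reflected \<rho> f z - g z * reflected \<rho> g z) holomorphic_on annulus a b"
      by (intro holomorphic_intros f g refl)
    show "sphere 0 \<rho> \<subseteq> annulus a b" using ab by (auto simp: annulus_def)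
    show "f w * reflected \<rho> f w - g w * reflected \<rho> g w = 0" if "w \<in> X" for w
      using X(1) equal_norm[OF that] that
      by (auto simp: reflected_def circle_reflection_on_circle simp flip: complex_norm_square)
  qed
  then show ?thesis by simp
qed

lemma equal_norm_on_circle_imp_reflected_identity:
  assumes f: "f holomorphic_on ball 0 1" and g: "g holomorphic_on ball 0 1" and r: "0 < r" "r < 1"
    and X: "X \<subseteq> sphere 0 r" "infinite X" and equal_norm: "\<And>z. z \<in> X \<Longrightarrow> norm (f z) = norm (g z)"
    and z: "z \<in> annulus (r\<^sup>2) 1"
  shows "f z * reflected r f z = g z * reflected r g z"
proof (rule equal_norm_imp_reflected_identity[OF _ _ _ _ _ _ X equal_norm z])
  show "f holomorphic_on annulus (r\<^sup>2) 1" "g holomorphic_on annulus (r\<^sup>2) 1"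
    using f g by (auto simp: annulus_def elim!: holomorphic_on_subset)
  show "r\<^sup>2 < r" using r power_strict_decreasing[of 1 2 r] by simp
qed (use r in simp_all)

lemma holomorphic_on_reflected_disc:
  assumes "h holomorphic_on ball 0 1"
  shows "reflected \<rho> h holomorphic_on annulus (\<rho>\<^sup>2) b"
proof (rule holomorphic_on_reflected[OF assms open_ball])
  show "0 \<notin> annulus (\<rho>\<^sup>2) b" by (simp add: annulus_def)
  show "circle_reflection \<rho> ` annulus (\<rho>\<^sup>2) b \<subseteq> ball 0 1"
  proof (rule image_subsetI)
    fix z assume "z \<in> annulus (\<rho>\<^sup>2) b"
    then have "\<rho>\<^sup>2 < norm z" by (simp add: annulus_def)
    moreover from this have "0 < norm z" by (rule le_less_trans[OF zero_le_power2])
    ultimately show "circle_reflection \<rho> z \<in> ball 0 1" by (simp add: norm_circle_reflection)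
  qed
qed

lemma equal_norm_reflected_on_unit_circle_imp_identity:
  assumes f: "f holomorphic_on ball 0 1" and g: "g holomorphic_on ball 0 1" and r: "0 < r" "r < 1"
    and Y: "infinite {z \<in> sphere 0 1. norm (reflected r f z) = norm (reflected r g z)}"
    and z: "z \<in> annulus (r\<^sup>2) (1 / r\<^sup>2)"
  shows "reflected r f z * f (complex_of_real (r\<^sup>2) * z) = reflected r g z * g (complex_of_real (r\<^sup>2) * z)"
proof -
  have r2: "0 < r\<^sup>2" "r\<^sup>2 < 1" using r by (simp_all add: power_less_one_iff)
  have "reflected r f z * reflected 1 (reflected r f) z = reflected r g z * reflected 1 (reflected r g) z"
    by (rule equal_norm_imp_reflected_identity[OF holomorphic_on_reflected_disc[OF f]
          holomorphic_on_reflected_disc[OF g] _ _ _ _ _ Y _ z])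
      (use r2 in \<open>auto simp: less_divide_eq\<close>)
  moreover have "z \<noteq> 0" using z r2 by (auto simp: annulus_def)
  ultimately show ?thesis by (simp add: reflected_1_reflected del: of_real_power)
qed

text \<open>With \<open>P\<close> and \<open>Q\<close> the reflections of \<open>g\<close> and \<open>f\<close>, the two hypotheses read \<open>f Q = g P\<close> and
  \<open>Q f(r\<^sup>2 w) = P g(r\<^sup>2 w)\<close>; eliminate \<open>P\<close> and cancel \<open>Q\<close>.\<close>

lemma reflected_identities_imp_scaling_identity_on_circle:
  assumes r: "0 < r" "r < 1"
    and inner: "\<And>z. z \<in> annulus (r\<^sup>2) 1 \<Longrightarrow> f z * reflected r f z = g z * reflected r g z"
    and outer: "\<And>z. z \<in> annulus (r\<^sup>2) (1 / r\<^sup>2) \<Longrightarrow>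
      reflected r f z * f (complex_of_real (r\<^sup>2) * z) = reflected r g z * g (complex_of_real (r\<^sup>2) * z)"
    and w: "norm w = r" "f w \<noteq> 0"
  shows "f w * g (complex_of_real (r\<^sup>2) * w) = g w * f (complex_of_real (r\<^sup>2) * w)"
proof -
  define P Q where "P = reflected r g w" and "Q = reflected r f w"
  have r_squared: "0 < r\<^sup>2" "r\<^sup>2 < r" "r\<^sup>2 < 1"
    using r power_strict_decreasing[of 1 2 r] by (simp_all add: power_less_one_iff)
  then have "1 < 1 / r\<^sup>2" by simp
  then have "r < 1 / r\<^sup>2" using r(2) by linarith
  then have "w \<in> annulus (r\<^sup>2) 1" "w \<in> annulus (r\<^sup>2) (1 / r\<^sup>2)"
    unfolding annulus_def mem_Collect_eq w(1) using r r_squared by simp_all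
  note identities = inner[OF this(1), folded P_def Q_def] outer[OF this(2), folded P_def Q_def]
  have "Q * (f w * g (complex_of_real (r\<^sup>2) * w)) = (f w * Q) * g (complex_of_real (r\<^sup>2) * w)"
    by (simp add: mult_ac)
  also have "\<dots> = g w * (P * g (complex_of_real (r\<^sup>2) * w))"
    unfolding identities(1) by (simp add: mult_ac)
  also have "\<dots> = Q * (g w * f (complex_of_real (r\<^sup>2) * w))"
    unfolding identities(2)[symmetric] by (simp add: mult_ac)
  finally show ?thesis
    using w by (simp add: Q_def reflected_def circle_reflection_on_circle)
qed

lemma reflected_identities_imp_scaling_identity:
  fixes X :: "complex set"
  assumes f: "f holomorphic_on ball 0 1" and g: "g holomorphic_on ball 0 1" and r: "0 < r" "r < 1"
    and nz: "norm z0 < 1" "f z0 \<noteq> 0" and X: "X \<subseteq> sphere 0 r" "infinite X"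
    and inner: "\<And>z. z \<in> annulus (r\<^sup>2) 1 \<Longrightarrow> f z * reflected r f z = g z * reflected r g z"
    and outer: "\<And>z. z \<in> annulus (r\<^sup>2) (1 / r\<^sup>2) \<Longrightarrow>
      reflected r f z * f (complex_of_real (r\<^sup>2) * z) = reflected r g z * g (complex_of_real (r\<^sup>2) * z)"
    and z: "norm z < 1"
  shows "f z * g (complex_of_real (r\<^sup>2) * z) = g z * f (complex_of_real (r\<^sup>2) * z)"
proof -
  have circle_in_disc: "sphere 0 r \<subseteq> ball (0::complex) 1" using r by auto
  define E where "E = (\<lambda>z. f z * g (complex_of_real (r\<^sup>2) * z) - g z * f (complex_of_real (r\<^sup>2) * z))"
  have "E z = 0"
  proof (rule holomorphic_eq_0_of_infinite_zeros[where f = E, OF _ open_ball connected_ball compact_sphere circle_in_disc])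
    have "(\<lambda>z. h (complex_of_real (r\<^sup>2) * z)) holomorphic_on ball 0 1" if "h holomorphic_on ball 0 1" for h
      by (rule dilation_on_disc(2)[OF that]) (use r in \<open>simp_all add: power_less_one_iff\<close>)
    note dilation = this[OF f] this[OF g]
    show "E holomorphic_on ball 0 1"
      unfolding E_def by (intro holomorphic_intros f g dilation)
    show "{w \<in> X. f w \<noteq> 0} \<subseteq> sphere 0 r" using X(1) by auto
    show "infinite {w \<in> X. f w \<noteq> 0}"
      by (rule infinite_nonzeros[OF f open_ball connected_ball compact_sphere circle_in_disc X, of z0])
        (use nz in simp_all)
    show "E w = 0" if "w \<in> {w \<in> X. f w \<noteq> 0}" for w
    proof -
      have "norm w = r" "f w \<noteq> 0" using that X(1) by auto
      from reflected_identities_imp_scaling_identity_on_circle[OF r inner outer this]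
      show ?thesis by (simp add: E_def)
    qed
  qed (use z in simp)
  then show ?thesis by (simp add: E_def)
qed

subsection \<open>Functions with a scaling identity\<close>

lemma power_mult_cancel_at_0:
  fixes F G :: "complex \<Rightarrow> complex"
  assumes cont: "isCont F 0" "isCont G 0"
    and "0 < R" and identity: "\<And>z. norm z < R \<Longrightarrow> z ^ n * F z = z ^ n * G z"
  shows "F 0 = G 0"
proof -
  have "\<forall>\<^sub>F z in at 0. norm z < R \<and> z \<noteq> (0::complex)"
    using \<open>0 < R\<close> by (auto simp: eventually_at dist_norm)
  then have "\<forall>\<^sub>F z in at 0. F z = G z"
    by eventually_elim (use identity in \<open>force\<close>)
  then have "(G \<longlongrightarrow> F 0) (at 0)"
    using cont(1) unfolding isCont_def by (rule Lim_transform_eventually[rotated])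
  then show ?thesis
    using cont(2) unfolding isCont_def by (rule tendsto_unique[OF at_neq_bot])
qed

lemma scaling_identity_imp_equal_order:
  fixes F G :: "complex \<Rightarrow> complex"
  assumes F: "isCont F 0" "F 0 \<noteq> 0" and G: "isCont G 0" "G 0 \<noteq> 0" and s: "0 < norm s" "norm s < 1" and R: "0 < R"
    and identity: "\<And>z. norm z < R \<Longrightarrow> (z ^ m * F z) * ((s * z) ^ n * G (s * z)) = (z ^ n * G z) * ((s * z) ^ m * F (s * z))"
  shows "m = n"
proof -
  have scaled: "isCont (\<lambda>z. H (s * z)) 0" if "isCont H 0" for H :: "complex \<Rightarrow> complex"
    by (rule isCont_o2[where f = "\<lambda>z. s * z"]) (use that in simp_all)
  have "s ^ n * (F 0 * G (s * 0)) = s ^ m * (G 0 * F (s * 0))"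
  proof (rule power_mult_cancel_at_0[where n = "m + n", OF _ _ R])
    show "isCont (\<lambda>z. s ^ n * (F z * G (s * z))) 0" "isCont (\<lambda>z. s ^ m * (G z * F (s * z))) 0"
      by (intro continuous_intros scaled F(1) G(1))+
    show "z ^ (m + n) * (s ^ n * (F z * G (s * z))) = z ^ (m + n) * (s ^ m * (G z * F (s * z)))" if "norm z < R" for z
      using identity[OF that] by (simp add: power_mult_distrib power_add mult_ac)
  qed
  then have "s ^ n = s ^ m" using F(2) G(2) by simp
  then have "norm s ^ n = norm s ^ m" by (metis norm_power)
  then show ?thesis using s power_inject_exp'[of "norm s" n m] by auto
qed

lemma scaling_identity_imp_factor_power:
  assumes f: "f holomorphic_on ball 0 1" and nzf: "norm z1 < 1" "f z1 \<noteq> 0"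
    and G: "isCont G 0" "G 0 \<noteq> 0" "\<And>z. norm z < 1 \<Longrightarrow> g z = z ^ n * G z"
    and s: "0 < norm s" "norm s < 1" and identity: "\<And>z. norm z < 1 \<Longrightarrow> f z * g (s * z) = g z * f (s * z)"
  obtains F where "isCont F 0" "F 0 \<noteq> 0" "\<And>z. norm z < 1 \<Longrightarrow> f z = z ^ n * F z"
proof -
  obtain m F where F: "F holomorphic_on ball 0 1" "F 0 \<noteq> 0" "\<And>z. norm z < 1 \<Longrightarrow> f z = z ^ m * F z"
    using holomorphic_on_disc_factor_power[OF f nzf] by blast
  have contF: "isCont F 0"
    using holomorphic_on_imp_continuous_on[OF F(1)] by (simp add: continuous_on_eq_continuous_at)
  have norm_scaled_less_1: "norm (s * z) < 1" if "norm z < 1" for z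
    using mult_strict_mono[OF s(2) that] by (simp add: norm_mult)
  have "m = n"
    by (rule scaling_identity_imp_equal_order[OF contF F(2) G(1,2) s zero_less_one])
      (metis identity F(3) G(3) norm_scaled_less_1)
  with that contF F show ?thesis by blast
qed

text \<open>Subtracting from \<open>f\<close> the multiple of \<open>g\<close> with the same leading coefficient at the origin raises the
  order there, whereas the identity forces it to be unchanged.\<close>

lemma scaling_identity_imp_proportional:
  assumes f: "f holomorphic_on ball 0 1" and g: "g holomorphic_on ball 0 1"
    and nzf: "norm z1 < 1" "f z1 \<noteq> 0" and nzg: "norm z2 < 1" "g z2 \<noteq> 0" and s: "0 < norm s" "norm s < 1"
    and identity: "\<And>z. norm z < 1 \<Longrightarrow> f z * g (s * z) = g z * f (s * z)"
  obtains c where "\<And>z. norm z < 1 \<Longrightarrow> f z = c * g z"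
proof -
  obtain n G where G: "isCont G 0" "G 0 \<noteq> 0" "\<And>z. norm z < 1 \<Longrightarrow> g z = z ^ n * G z"
    using holomorphic_on_disc_factor_power[OF g nzg] holomorphic_on_imp_continuous_on
    by (metis continuous_on_eq_continuous_at mem_ball_0 norm_zero open_ball zero_less_one)
  obtain F where F: "isCont F 0" "F 0 \<noteq> 0" "\<And>z. norm z < 1 \<Longrightarrow> f z = z ^ n * F z"
    using scaling_identity_imp_factor_power[OF f nzf G s identity] by blast
  define c where "c = F 0 / G 0"
  define h where "h = (\<lambda>z. f z - c * g z)"
  have "h z = 0" if z: "norm z < 1" for z
  proof (rule ccontr)
    assume "h z \<noteq> 0"
    have h: "h holomorphic_on ball 0 1" unfolding h_def by (intro holomorphic_intros f g)
    have "h w * g (s * w) = g w * h (s * w)" if "norm w < 1" for w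
      using identity[OF that] by (simp add: h_def algebra_simps)
    then obtain H where H: "isCont H 0" "H 0 \<noteq> 0" "\<And>w. norm w < 1 \<Longrightarrow> h w = w ^ n * H w"
      using scaling_identity_imp_factor_power[OF h z \<open>h z \<noteq> 0\<close> G s] by blast
    have "F 0 - c * G 0 = H 0"
    proof (rule power_mult_cancel_at_0[OF _ H(1) zero_less_one])
      show "isCont (\<lambda>w. F w - c * G w) 0" by (intro continuous_intros F(1) G(1))
      show "w ^ n * (F w - c * G w) = w ^ n * H w" if "norm w < 1" for w
        using F(3)[OF that] G(3)[OF that] H(3)[OF that] by (simp add: h_def algebra_simps)
    qed
    with H(2) G(2) show False by (simp add: c_def)
  qed
  then show ?thesis using that[of c] by (simp add: h_def)
qed

subsection \<open>Hardy functions of equal modulus on two circles\<close>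

lemma isCont_reflected_on_unit_circle:
  assumes "h holomorphic_on ball 0 1" "\<bar>r\<bar> < 1" "norm z = 1"
  shows "isCont (reflected r h) z"
proof -
  have "circle_reflection r z \<in> ball 0 1"
    using assms(2,3) by (simp add: norm_circle_reflection abs_square_less_1)
  then have "isCont h (circle_reflection r z)"
    using holomorphic_on_imp_continuous_on[OF assms(1)] by (simp add: continuous_on_eq_continuous_at)
  moreover have "isCont (circle_reflection r) z"
    unfolding circle_reflection_def[abs_def] using assms(3) by (intro continuous_intros) auto
  ultimately have "isCont (\<lambda>z. h (circle_reflection r z)) z"
    by (rule isCont_o2[rotated])
  then show ?thesis
    unfolding reflected_def[abs_def] by (rule continuous_cnj)
qed

lemma hardy1_equal_norm_reflected_on_unit_circle:
  assumes f: "hardy1 f" "norm z1 < 1" "f z1 \<noteq> 0" and g: "hardy1 g" "norm z2 < 1" "g z2 \<noteq> 0"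
    and boundary: "AE t in lborel. t \<in> {0..2*pi} \<longrightarrow> norm (radial_limit f t) = norm (radial_limit g t)"
    and r: "0 < r" "r < 1"
    and inner: "\<And>z. z \<in> annulus (r\<^sup>2) 1 \<Longrightarrow> f z * reflected r f z = g z * reflected r g z"
  shows "infinite {z \<in> sphere 0 1. norm (reflected r f z) = norm (reflected r g z)}"
proof (rule infinite_on_circle_of_AE)
  have holo: "f holomorphic_on ball 0 1" "g holomorphic_on ball 0 1"
    using f(1) g(1) by (simp_all add: hardy1_def)
  show "AE t in lborel. t \<in> {0..2*pi} \<longrightarrow> norm (reflected r f (cis t)) = norm (reflected r g (cis t))"
    using boundary hardy1_AE_nonzero_radial_limit[OF f] hardy1_AE_nonzero_radial_limit[OF g]
  proof eventually_elim
    case (elim t)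
    show ?case
    proof
      assume t: "t \<in> {0..2*pi}"
      obtain a b where ab: "has_radial_limit f t a" "a \<noteq> 0" "has_radial_limit g t b" "b \<noteq> 0"
        using elim t by blast
      show "norm (reflected r f (cis t)) = norm (reflected r g (cis t))"
      proof (rule norm_eq_at_boundary_of_radial_limits[OF ab(3,1)])
        show "norm b = norm a" "b \<noteq> 0" using elim(1) t ab by (auto simp: radial_limit_eq)
        show "isCont (reflected r f) (cis t)" "isCont (reflected r g) (cis t)"
          using r by (simp_all add: isCont_reflected_on_unit_circle holo)
        show "r\<^sup>2 < 1" using r by (simp add: power_less_one_iff)
        show "g z * reflected r g z = f z * reflected r f z" if "r\<^sup>2 < norm z" "norm z < 1" for z
          by (rule inner[symmetric]) (use that in \<open>simp add: annulus_def\<close>)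
      qed
    qed
  qed
qed

lemma eq_0_on_disc_of_equal_norm:
  assumes g: "g holomorphic_on ball 0 1" and X: "X \<subseteq> sphere 0 r" "infinite X" "r < 1"
    and equal_norm: "\<And>z. z \<in> X \<Longrightarrow> norm (f z) = norm (g z)" and f: "\<And>z. z \<in> ball 0 1 \<Longrightarrow> f z = 0" and z: "z \<in> ball 0 1"
  shows "g z = 0"
proof (rule holomorphic_eq_0_of_infinite_zeros[OF g open_ball connected_ball compact_sphere _ X(1,2) _ z])
  show "sphere 0 r \<subseteq> ball (0::complex) 1" using X(3) by auto
  show "g w = 0" if "w \<in> X" for w
    using equal_norm[OF that] f[of w] X that by auto
qed

lemma vanishing_iff_of_equal_norm:
  assumes f: "f holomorphic_on ball 0 1" and g: "g holomorphic_on ball 0 1"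
    and X: "X \<subseteq> sphere 0 r" "infinite X" "r < 1" and equal_norm: "\<And>z. z \<in> X \<Longrightarrow> norm (f z) = norm (g z)"
  shows "(\<forall>z\<in>ball 0 1. f z = 0) \<longleftrightarrow> (\<forall>z\<in>ball 0 1. g z = 0)"
proof (intro iffI ballI)
  show "g z = 0" if "\<forall>z\<in>ball 0 1. f z = 0" "z \<in> ball 0 1" for z
    by (rule eq_0_on_disc_of_equal_norm[where f = f, OF g X]) (use that equal_norm in simp_all)
  show "f z = 0" if "\<forall>z\<in>ball 0 1. g z = 0" "z \<in> ball 0 1" for z
    by (rule eq_0_on_disc_of_equal_norm[where f = g, OF f X]) (use that equal_norm in simp_all)
qed

lemma norm_multiplier_eq_1:
  assumes g: "g holomorphic_on ball 0 1" "norm z0 < 1" "g z0 \<noteq> 0"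
    and X: "X \<subseteq> sphere 0 r" "infinite X" "r < 1" and equal_norm: "\<And>z. z \<in> X \<Longrightarrow> norm (f z) = norm (g z)"
    and c: "\<And>z. norm z < 1 \<Longrightarrow> f z = c * g z"
  shows "norm c = 1"
proof -
  have "infinite {x \<in> X. g x \<noteq> 0}"
    by (rule infinite_nonzeros[OF g(1) open_ball connected_ball compact_sphere _ X(1,2), of z0]) (use X(3) g in auto)
  then obtain x where x: "x \<in> X" "g x \<noteq> 0"
    by (metis (mono_tags, lifting) empty_Collect_eq finite.emptyI)
  then have "norm x < 1" using X by auto
  then have "norm c * norm (g x) = norm (g x)"
    using c[of x] equal_norm[OF x(1)] by (simp add: norm_mult)
  then show ?thesis using x(2) by simp
qed

theorem theorem2p8:
  fixes f g :: "complex \<Rightarrow> complex" and X :: "complex set" and r :: real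
  assumes "hardy1 f" and "hardy1 g"
    and "AE t in lborel. t \<in> {0..2*pi} \<longrightarrow>
           norm (radial_limit f t) = norm (radial_limit g t)"
    and "0 < r" and "r < 1"
    and "X \<subseteq> sphere 0 r" and "infinite X"
    and "\<forall>z\<in>X. norm (f z) = norm (g z)"
  shows "\<exists>c. norm c = 1 \<and> (\<forall>z\<in>ball 0 1. f z = c * g z)"
proof -
  have f: "f holomorphic_on ball 0 1" and g: "g holomorphic_on ball 0 1"
    using assms(1,2) by (simp_all add: hardy1_def)
  have equal_norm: "norm (f z) = norm (g z)" if "z \<in> X" for z using assms(8) that by simp
  show ?thesis
  proof (cases "\<forall>z\<in>ball 0 1. f z = 0")
    case True
    then show ?thesis
      using vanishing_iff_of_equal_norm[OF f g assms(6,7,5) equal_norm] by (intro exI[of _ 1]) simp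
  next
    case False
    then obtain z1 z2 where z1: "norm z1 < 1" "f z1 \<noteq> 0" and z2: "norm z2 < 1" "g z2 \<noteq> 0"
      using vanishing_iff_of_equal_norm[OF f g assms(6,7,5) equal_norm] by (metis mem_ball_0)
    note inner = equal_norm_on_circle_imp_reflected_identity[OF f g assms(4-7) equal_norm]
    note outer = equal_norm_reflected_on_unit_circle_imp_identity[OF f g assms(4,5)
        hardy1_equal_norm_reflected_on_unit_circle[OF assms(1) z1 assms(2) z2 assms(3-5) inner]]
    have "0 < norm (complex_of_real (r\<^sup>2))" "norm (complex_of_real (r\<^sup>2)) < 1"
      using assms(4,5) by (simp_all add: power_less_one_iff del: of_real_power)
    then obtain c where c: "\<And>z. norm z < 1 \<Longrightarrow> f z = c * g z"
      using scaling_identity_imp_proportional[OF f g z1 z2]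
        reflected_identities_imp_scaling_identity[OF f g assms(4,5) z1 assms(6,7) inner outer] by metis
    moreover have "norm c = 1" by (rule norm_multiplier_eq_1[OF g z2 assms(6,7,5) equal_norm c])
    ultimately show ?thesis by auto
  qed
qed

end
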